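(* Let $n = q^{m}-1$, where $q \geq 3$ is a prime power and $m \geq 2$ is an even integer. Then for every integer $c$ with $2 \leq c \leq q$ there exists a quantum code with parameters $[[n,\; n-2m(c-2)-m/2-1,\; d \geq c]]_{q}$.
   Context: An $[[n,K,d]]_q$ quantum code is a $q^{K}$-dimensional complex subspace $Q$ of $(\mathbb{C}^{q})^{\otimes n}$ with minimum distance $d$; "$d\geq c$" means that the minimum distance is at least $c$, i.e. every error operator $E$ acting nontrivially on at most $c-1$ of the $n$ tensor factors is detectable: $PEP=\lambda_E P$ for some scalar $\lambda_E$, where $P$ is the orthogonal projector onto $Q$. *)

theory Defs
  imports Complex_Main "HOL-Library.FuncSet" "HOL-Library.Function_Algebras"
    "HOL-Number_Theory.Prime_Powers"
begin

text \<open>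
  The space \<open>(\<complex>\<^sup>q)\<^sup>\<otimes>\<^sup>n\<close> is realised in coordinates: the product basis is indexed by the words of
  length \<open>n\<close> over \<open>{0, \<dots>, q - 1}\<close>, and a vector is its family of coefficients, extended by \<open>0\<close>
  outside the words. The tensor factors are numbered by \<open>{..<n}\<close>.
\<close>

type_synonym ket = "(nat \<Rightarrow> nat) \<Rightarrow> complex"

definition words :: "nat set \<Rightarrow> nat \<Rightarrow> (nat \<Rightarrow> nat) set" where
  "words S q = S \<rightarrow>\<^sub>E {..<q}"

definition state_space :: "nat \<Rightarrow> nat \<Rightarrow> ket set" where
  "state_space q n = {\<psi>. \<forall>x. x \<notin> words {..<n} q \<longrightarrow> \<psi> x = 0}"

definition kscale :: "complex \<Rightarrow> ket \<Rightarrow> ket" where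
  "kscale a \<psi> = (\<lambda>x. a * \<psi> x)"

interpretation ket: vector_space kscale
  by unfold_locales (auto simp: kscale_def fun_eq_iff algebra_simps)

definition kinner :: "nat \<Rightarrow> nat \<Rightarrow> ket \<Rightarrow> ket \<Rightarrow> complex" where
  "kinner q n \<phi> \<psi> = (\<Sum>x\<in>words {..<n} q. cnj (\<phi> x) * \<psi> x)"

text \<open>
  For a subspace \<open>Q\<close> of \<open>state_space q n\<close>, the conditions below determine \<open>P\<close> uniquely on
  \<open>state_space q n\<close>.
\<close>

definition orth_projector :: "nat \<Rightarrow> nat \<Rightarrow> ket set \<Rightarrow> (ket \<Rightarrow> ket) \<Rightarrow> bool" where
  "orth_projector q n Q P \<longleftrightarrow>
     (\<forall>\<psi>\<in>state_space q n. P \<psi> \<in> Q \<and> (\<forall>\<phi>\<in>Q. kinner q n \<phi> (\<psi> - P \<psi>) = 0))"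

text \<open>
  The operator \<open>A \<otimes> I\<close>, where the linear operator \<open>A\<close> on the tensor factors in \<open>S\<close> is given by its
  matrix entries \<open>A a b\<close> (\<open>a\<close>, \<open>b\<close> words over the positions in \<open>S\<close>) and \<open>I\<close> is the identity on
  the tensor factors outside \<open>S\<close>.
\<close>

definition local_operator ::
  "nat \<Rightarrow> nat \<Rightarrow> nat set \<Rightarrow> ((nat \<Rightarrow> nat) \<Rightarrow> (nat \<Rightarrow> nat) \<Rightarrow> complex) \<Rightarrow> ket \<Rightarrow> ket" where
  "local_operator q n S A \<psi> =
     (\<lambda>x. if x \<in> words {..<n} q
          then \<Sum>b\<in>words S q. A (restrict x S) b * \<psi> (override_on x b S) else 0)"

definition detectable :: "nat \<Rightarrow> nat \<Rightarrow> ket set \<Rightarrow> (ket \<Rightarrow> ket) \<Rightarrow> bool" where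
  "detectable q n Q E \<longleftrightarrow>
     (\<exists>P. orth_projector q n Q P \<and>
        (\<exists>l. \<forall>\<psi>\<in>state_space q n. P (E (P \<psi>)) = kscale l (P \<psi>)))"

definition min_dist_ge :: "nat \<Rightarrow> nat \<Rightarrow> ket set \<Rightarrow> nat \<Rightarrow> bool" where
  "min_dist_ge q n Q c \<longleftrightarrow>
     (\<forall>S A. S \<subseteq> {..<n} \<and> card S \<le> c - 1 \<longrightarrow> detectable q n Q (local_operator q n S A))"

text \<open>\<open>Q\<close> is an \<open>[[n, K, d \<ge> c]]\<^sub>q\<close> quantum code.\<close>

definition quantum_code :: "nat \<Rightarrow> nat \<Rightarrow> nat \<Rightarrow> nat \<Rightarrow> ket set \<Rightarrow> bool" where
  "quantum_code q n K c Q \<longleftrightarrow>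
     Q \<subseteq> state_space q n \<and> ket.subspace Q \<and> ket.dim Q = q ^ K \<and> min_dist_ge q n Q c"

end

theory Submission
  imports Defs "Jordan_Normal_Form.Char_Poly" "HOL-Number_Theory.Cong"
begin

text \<open>
  The code is a CSS code. Let \<open>\<omega>\<close> enumerate the nonzero elements of the field with \<open>q ^ m\<close> elements, let
  \<open>h = m div 2\<close>, let \<open>Tr\<close> be the trace to the subfield \<open>G\<close> with \<open>q\<close> elements, and put
  \<open>A = {(Tr (\<Sum>k\<le>c - 2. \<beta> k * \<omega> j ^ (q ^ h + 1 + k)))\<^sub>j}\<close> and
  \<open>B = {v. \<forall>i\<le>c - 2. (\<Sum>j. v j * \<omega> j ^ (-i)) = 0}\<close>, both inside \<open>G ^ n\<close>. By polynomial interpolation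
  \<open>B\<close> has minimum distance at least \<open>c\<close> and \<open>A\<close> projects onto any \<open>c - 1\<close> coordinates; comparing base-\<open>q\<close>
  digits of exponents gives \<open>A \<subseteq> B\<close>. The exponent \<open>q ^ h + 1\<close> is fixed by multiplication with \<open>q ^ h\<close>
  modulo \<open>q ^ m - 1\<close>, which makes \<open>A\<close> smaller by a factor \<open>q ^ h\<close> than one would expect.

  The states that are constant on the cosets of \<open>A\<close> in \<open>B\<close> form the code. A local operator cannot move one
  word of \<open>B\<close> to another one, so only its diagonal acts, and it acts on every coset with the same average, because
  the words of a coset are equidistributed on any \<open>c - 1\<close> coordinates. Subspaces inherit detectability, so
  bounds for the sizes of \<open>A\<close> and \<open>B\<close> suffice.
\<close>

hide_const (open) module.smult

subsection \<open>Quantum codes from pairs of additive codes\<close>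

lemma finite_words: "finite S \<Longrightarrow> finite (words S q)"
  unfolding words_def by (intro finite_PiE) auto

lemma restrict_words: "x \<in> words T q \<Longrightarrow> S \<subseteq> T \<Longrightarrow> restrict x S \<in> words S q"
  unfolding words_def by (auto simp: PiE_def Pi_def)

text \<open>The code consists of the functions that are constant on each block of \<open>D\<close>
  and vanish outside the blocks. Here \<open>sep\<close> is the distance condition for the union of
  all blocks, and \<open>unif\<close> the equidistribution of a block on few coordinates; its count
  does not depend on the block, so neither does the resulting scalar.\<close>

lemma uniform_code_exists:
  fixes D :: "(nat \<Rightarrow> nat) set set"
  assumes sub: "\<And>C. C \<in> D \<Longrightarrow> C \<subseteq> words {..<n} q"
    and disj: "\<And>C C' x. C \<in> D \<Longrightarrow> C' \<in> D \<Longrightarrow> x \<in> C \<Longrightarrow> x \<in> C' \<Longrightarrow> C = C'"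
    and card_C: "\<And>C. C \<in> D \<Longrightarrow> card C = s" and s: "s > 0"
    and sep: "\<And>S C C' x y. S \<subseteq> {..<n} \<Longrightarrow> card S \<le> c - 1 \<Longrightarrow> C \<in> D \<Longrightarrow> C' \<in> D \<Longrightarrow>
      x \<in> C \<Longrightarrow> y \<in> C' \<Longrightarrow> (\<And>j. j \<notin> S \<Longrightarrow> x j = y j) \<Longrightarrow> x = y"
    and unif: "\<And>S. S \<subseteq> {..<n} \<Longrightarrow> card S \<le> c - 1 \<Longrightarrow>
      \<exists>t. \<forall>C\<in>D. \<forall>a\<in>words S q. card {x\<in>C. restrict x S = a} = t"
    and card_D: "card D = q ^ K"
  shows "\<exists>Q. quantum_code q n K c Q"
proof -
  have finw: "finite (words {..<n} q)" by (simp add: finite_words)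
  have finC: "finite C" if "C \<in> D" for C
    using sub[OF that] finw finite_subset by blast
  have finD: "finite D"
    using sub finw by (meson PowI finite_Pow_iff finite_subset subsetI)
  \<comment> \<open>\<open>syn f\<close> takes the value \<open>f C\<close> on the block
    \<open>C\<close>, and \<open>avg\<close> takes means over blocks; averaging followed by
    \<open>syn\<close> is the orthogonal projector.\<close>
  define syn :: "((nat \<Rightarrow> nat) set \<Rightarrow> complex) \<Rightarrow> ket"
    where "syn f = (\<lambda>x. \<Sum>C\<in>D. f C * of_bool (x \<in> C))" for f
  define avg :: "ket \<Rightarrow> (nat \<Rightarrow> nat) set \<Rightarrow> complex"
    where "avg \<psi> C = (\<Sum>x\<in>C. \<psi> x) / of_nat s" for \<psi> C
  define Q where "Q = range syn"
  have syn_cong: "syn f = syn g" if "\<And>C. C \<in> D \<Longrightarrow> f C = g C" for f g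
    unfolding syn_def using that by simp
  have syn_in: "syn f x = f C" if "C \<in> D" "x \<in> C" for f C x
  proof -
    have "syn f x = (\<Sum>C'\<in>D. if C' = C then f C else 0)"
      unfolding syn_def by (rule sum.cong) (use that disj in auto)
    also have "\<dots> = f C" using finD that by simp
    finally show ?thesis .
  qed
  have syn_out: "syn f x = 0" if "\<And>C. C \<in> D \<Longrightarrow> x \<notin> C" for f x
    unfolding syn_def using that by simp
  have sum_D: "(\<Sum>x\<in>words {..<n} q. h x) = (\<Sum>C\<in>D. \<Sum>x\<in>C. h x)"
    if "\<And>x. (\<And>C. C \<in> D \<Longrightarrow> x \<notin> C) \<Longrightarrow> h x = 0" for h :: ket
  proof -
    have "(\<Sum>C\<in>D. \<Sum>x\<in>C. h x) = sum h (\<Union>C\<in>D. C)"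
      by (rule sum.UNION_disjoint[symmetric]) (use finD finC disj in auto)
    also have "\<dots> = sum h (words {..<n} q)"
      by (rule sum.mono_neutral_left) (use finw sub that in auto)
    finally show ?thesis by simp
  qed
  have Q_state: "Q \<subseteq> state_space q n"
    unfolding Q_def state_space_def using syn_out sub by blast
  have Q_subspace: "ket.subspace Q"
  proof (rule ket.subspaceI)
    have "syn (\<lambda>_. 0) = 0" by (simp add: syn_def fun_eq_iff)
    then show "0 \<in> Q" unfolding Q_def by (metis rangeI)
  next
    fix x y assume "x \<in> Q" "y \<in> Q"
    then obtain f g where "x = syn f" "y = syn g" unfolding Q_def by auto
    then have "x + y = syn (\<lambda>C. f C + g C)"
      by (simp add: syn_def fun_eq_iff sum.distrib algebra_simps)
    then show "x + y \<in> Q" unfolding Q_def by auto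
  next
    fix a x assume "x \<in> Q"
    then obtain f where "x = syn f" unfolding Q_def by auto
    then have "kscale a x = syn (\<lambda>C. a * f C)"
      by (simp add: syn_def fun_eq_iff kscale_def sum_distrib_left mult.assoc)
    then show "kscale a x \<in> Q" unfolding Q_def by auto
  qed
  \<comment> \<open>The indicator functions of the blocks form a basis of \<open>Q\<close>, which
    gives dimension \<open>card D\<close>.\<close>
  define ind where "ind C = syn (\<lambda>C'. of_bool (C' = C))" for C
  have syn_ind: "syn f = (\<Sum>C\<in>D. kscale (f C) (ind C))" for f
  proof
    fix x
    have "(\<Sum>C\<in>D. kscale (f C) (ind C)) x = (\<Sum>C\<in>D. f C * ind C x)"
      by (induction D rule: infinite_finite_induct) (auto simp: kscale_def)
    also have "\<dots> = syn f x"
    proof (cases "\<exists>C\<in>D. x \<in> C")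
      case True
      then obtain C where C: "C \<in> D" "x \<in> C" by auto
      have "(\<Sum>C\<in>D. f C * ind C x) = (\<Sum>C'\<in>D. if C' = C then f C else 0)"
        by (rule sum.cong) (auto simp: ind_def syn_in[OF C])
      then show ?thesis using finD C by (simp add: syn_in[OF C])
    next
      case False
      then show ?thesis unfolding ind_def using syn_out by simp
    qed
    finally show "syn f x = (\<Sum>C\<in>D. kscale (f C) (ind C)) x" by simp
  qed
  have nonempty: "\<exists>x. x \<in> C" if "C \<in> D" for C
    using card_C[OF that] s by (metis card.empty equals0I less_numeral_extra(3))
  have syn_inj: "f C = g C" if eq: "syn f = syn g" and C: "C \<in> D" for f g C
    using nonempty[OF C] syn_in[OF C] eq by metis
  have inj_ind: "inj_on ind D"
  proof (rule inj_onI)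
    fix C C' assume "C \<in> D" "C' \<in> D" "ind C = ind C'"
    then have "(of_bool (C = C) :: complex) = of_bool (C = C')"
      using syn_inj unfolding ind_def by blast
    then show "C = C'" by simp
  qed
  have indep: "ket.independent (ind ` D)"
  proof (rule ket.independent_if_scalars_zero)
    show "finite (ind ` D)" using finD by simp
    fix f \<phi> assume z: "(\<Sum>x\<in>ind ` D. kscale (f x) x) = 0" and "\<phi> \<in> ind ` D"
    then obtain C where C: "C \<in> D" "\<phi> = ind C" by auto
    have "syn (\<lambda>C. f (ind C)) = syn (\<lambda>_. 0)"
      using z by (simp add: syn_ind[of "\<lambda>C. f (ind C)"] sum.reindex[OF inj_ind] comp_def)
        (simp add: syn_def fun_eq_iff)
    then show "f \<phi> = 0"
      using syn_inj[of "\<lambda>C. f (ind C)" "\<lambda>_. 0" C] C by simp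
  qed
  have dim: "ket.dim Q = q ^ K"
  proof (rule ket.dim_unique)
    show "ind ` D \<subseteq> Q" unfolding Q_def ind_def by auto
    show "Q \<subseteq> ket.span (ind ` D)"
    proof
      fix \<phi> assume "\<phi> \<in> Q"
      then obtain f where "\<phi> = syn f" unfolding Q_def by auto
      then show "\<phi> \<in> ket.span (ind ` D)"
        by (simp add: syn_ind ket.span_sum ket.span_scale ket.span_base)
    qed
    show "card (ind ` D) = q ^ K" using card_image[OF inj_ind] card_D by simp
  qed (rule indep)
  have proj: "orth_projector q n Q (\<lambda>\<psi>. syn (avg \<psi>))"
    unfolding orth_projector_def
  proof (intro ballI conjI)
    fix \<psi> \<phi> assume "\<phi> \<in> Q"
    then obtain f where f: "\<phi> = syn f" unfolding Q_def by auto
    have "kinner q n \<phi> (\<psi> - syn (avg \<psi>)) =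
       (\<Sum>C\<in>D. \<Sum>x\<in>C. cnj (\<phi> x) * (\<psi> - syn (avg \<psi>)) x)"
      unfolding kinner_def by (rule sum_D) (simp add: f syn_out)
    also have "\<dots> = (\<Sum>C\<in>D. \<Sum>x\<in>C. cnj (f C) * (\<psi> x - avg \<psi> C))"
      by (intro sum.cong refl) (simp add: f syn_in)
    also have "\<dots> = (\<Sum>C\<in>D. 0)"
    proof (rule sum.cong)
      fix C assume C: "C \<in> D"
      \<comment> \<open>Subtracting the mean over a block leaves a function with sum zero there,
        hence orthogonal to constants on the block.\<close>
      have "(\<Sum>x\<in>C. \<psi> x - avg \<psi> C) = 0"
        using s by (simp add: sum_subtractf card_C[OF C] avg_def)
      then show "(\<Sum>x\<in>C. cnj (f C) * (\<psi> x - avg \<psi> C)) = 0"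
        by (simp flip: sum_distrib_left)
    qed simp
    finally show "kinner q n \<phi> (\<psi> - syn (avg \<psi>)) = 0" by simp
  qed (auto simp: Q_def)
  have "detectable q n Q (local_operator q n S A)"
    if S: "S \<subseteq> {..<n}" "card S \<le> c - 1" for S A
  proof -
    have finS: "finite S" using S(1) finite_subset by blast
    obtain t where t: "\<And>C a. C \<in> D \<Longrightarrow> a \<in> words S q \<Longrightarrow> card {x\<in>C. restrict x S = a} = t"
      using unif[OF S] by blast
    \<comment> \<open>A block has \<open>s\<close> words, exactly \<open>t\<close> of which restrict
      to any given \<open>a\<close>, so \<open>l\<close> is the mean of the diagonal entries of
      \<open>A\<close> over a block.\<close>
    define l where "l = (\<Sum>a\<in>words S q. of_nat t * A a a) / of_nat s"
    have E: "local_operator q n S A (syn f) x = A (restrict x S) (restrict x S) * f C"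
      if C: "C \<in> D" and x: "x \<in> C" for f C x
    proof -
      have xw: "x \<in> words {..<n} q" using sub C x by auto
      have ov: "override_on x (restrict x S) S = x"
        by (auto simp: override_on_def)
      \<comment> \<open>If the modified word lies in some block, it agrees with \<open>x\<close>
        outside \<open>S\<close>, and \<open>sep\<close> makes it equal to \<open>x\<close>. So only
        the diagonal term of the sum over \<open>b\<close> survives.\<close>
      have "syn f (override_on x b S) = (if b = restrict x S then f C else 0)"
        if b: "b \<in> words S q" for b
      proof (cases "\<exists>C'\<in>D. override_on x b S \<in> C'")
        case True
        then obtain C' where C': "C' \<in> D" "override_on x b S \<in> C'" by auto
        have eq: "x = override_on x b S"
          by (rule sep[OF S C C'(1) x C'(2)]) (simp add: override_on_def)
        have "b = restrict x S"
        proof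
          fix j show "b j = restrict x S j"
            using b fun_cong[OF eq, of j] by (auto simp: words_def override_on_def PiE_def extensional_def)
        qed
        then show ?thesis using ov syn_in[OF C x] by simp
      next
        case False
        then have "b \<noteq> restrict x S" using ov C x by auto
        then show ?thesis using False syn_out by simp
      qed
      then have "(\<Sum>b\<in>words S q. A (restrict x S) b * syn f (override_on x b S)) =
        (\<Sum>b\<in>words S q. if b = restrict x S then A (restrict x S) (restrict x S) * f C else 0)"
        by (intro sum.cong) auto
      also have "\<dots> = A (restrict x S) (restrict x S) * f C"
        using finite_words[OF finS] restrict_words[OF xw S(1)] by simp
      finally show ?thesis unfolding local_operator_def using xw by simp
    qed
    have avgE: "avg (local_operator q n S A (syn f)) C = l * f C" if C: "C \<in> D" for f C
    proof -
      have "(\<Sum>x\<in>C. local_operator q n S A (syn f) x) =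
          (\<Sum>x\<in>C. A (restrict x S) (restrict x S) * f C)"
        using E[OF C] by simp
      also have "\<dots> = (\<Sum>a\<in>words S q. \<Sum>x\<in>{x\<in>C. restrict x S = a}. A (restrict x S) (restrict x S) * f C)"
        by (rule sum.group[symmetric])
          (use finC[OF C] finite_words[OF finS] sub[OF C] restrict_words[OF _ S(1)] in auto)
      also have "\<dots> = (\<Sum>a\<in>words S q. of_nat t * A a a * f C)"
      proof (rule sum.cong)
        fix a assume a: "a \<in> words S q"
        have "(\<Sum>x\<in>{x\<in>C. restrict x S = a}. A (restrict x S) (restrict x S) * f C) =
          (\<Sum>x\<in>{x\<in>C. restrict x S = a}. A a a * f C)"
          by (rule sum.cong) auto
        then show "(\<Sum>x\<in>{x\<in>C. restrict x S = a}. A (restrict x S) (restrict x S) * f C) =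
          of_nat t * A a a * f C"
          using t[OF C a] by simp
      qed simp
      finally show ?thesis
        unfolding avg_def l_def by (simp add: sum_distrib_right)
    qed
    have "syn (avg (local_operator q n S A (syn f))) = kscale l (syn f)" for f
    proof -
      have "syn (avg (local_operator q n S A (syn f))) = syn (\<lambda>C. l * f C)"
        by (rule syn_cong) (rule avgE)
      then show ?thesis
        by (simp add: fun_eq_iff kscale_def syn_def sum_distrib_left mult.assoc)
    qed
    then show ?thesis unfolding detectable_def using proj by blast
  qed
  then have "min_dist_ge q n Q c" unfolding min_dist_ge_def by blast
  then show ?thesis
    unfolding quantum_code_def using Q_state Q_subspace dim by blast
qed

text \<open>The blocks are cosets of \<open>A\<close> in \<open>B\<close>, relabelled through
  \<open>g\<close> as words over \<open>{..<q}\<close>. Differences of elements of \<open>B\<close>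
  stay in \<open>B\<close>, so \<open>dist\<close> yields separation; by \<open>surj\<close> the
  elements of a coset with prescribed values on \<open>S\<close> form a translate of the part of
  \<open>A\<close> vanishing on \<open>S\<close>, so their number is constant. An inequality between
  the sizes suffices because any selection of \<open>q ^ K\<close> cosets will do.\<close>

lemma css_code_exists:
  fixes g :: "nat \<Rightarrow> 'a::ab_group_add" and A B :: "(nat \<Rightarrow> 'a) set"
  assumes inj: "inj_on g {..<q}"
    and G_diff: "\<And>a b. a \<in> g ` {..<q} \<Longrightarrow> b \<in> g ` {..<q} \<Longrightarrow> a - b \<in> g ` {..<q}"
    and B_val: "\<And>v j. v \<in> B \<Longrightarrow> j < n \<Longrightarrow> v j \<in> g ` {..<q}"
    and B_supp: "\<And>v j. v \<in> B \<Longrightarrow> j \<ge> n \<Longrightarrow> v j = 0"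
    and A_sub: "A \<subseteq> B" and A_0: "0 \<in> A"
    and A_diff: "\<And>v w. v \<in> A \<Longrightarrow> w \<in> A \<Longrightarrow> v - w \<in> A"
    and B_diff: "\<And>v w. v \<in> B \<Longrightarrow> w \<in> B \<Longrightarrow> v - w \<in> B"
    and dist: "\<And>S v. S \<subseteq> {..<n} \<Longrightarrow> card S \<le> c - 1 \<Longrightarrow> v \<in> B \<Longrightarrow> (\<And>j. j \<notin> S \<Longrightarrow> v j = 0) \<Longrightarrow> v = 0"
    and surj: "\<And>S u. S \<subseteq> {..<n} \<Longrightarrow> card S \<le> c - 1 \<Longrightarrow> (\<And>j. j \<in> S \<Longrightarrow> u j \<in> g ` {..<q}) \<Longrightarrow>
      \<exists>a\<in>A. \<forall>j\<in>S. a j = u j"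
    and card_le: "q ^ K * card A \<le> card B"
  shows "\<exists>Q. quantum_code q n K c Q"
proof -
  \<comment> \<open>The value \<open>undefined\<close> outside \<open>{..<n}\<close> matches the
    extensional functions in \<open>words\<close>.\<close>
  define w where "w v = (\<lambda>j. if j < n then inv_into {..<q} g (v j) else undefined)" for v :: "nat \<Rightarrow> 'a"
  have w_words: "w v \<in> words {..<n} q" if "v \<in> B" for v
    using B_val[OF that] inv_into_into[of _ g "{..<q}"]
    by (auto simp: w_def words_def PiE_def extensional_def Pi_def)
  have g_w: "g (w v j) = v j" if "v \<in> B" "j < n" for v j
    using B_val[OF that] that(2) by (simp add: w_def f_inv_into_f)
  have w_eqD: "v j = v' j" if "v \<in> B" "v' \<in> B" "w v j = w v' j" for v v' j
    using that g_w B_supp by (metis not_less)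
  have inj_w: "inj_on w B"
    by (rule inj_onI) (use w_eqD in \<open>auto simp: fun_eq_iff\<close>)
  have finB: "finite B"
    using w_words finite_words[of "{..<n}" q] by (intro inj_on_finite[OF inj_w]) auto
  have finA: "finite A" using A_sub finB finite_subset by blast
  have A_pos: "card A > 0" using A_0 finA by (auto simp: card_gt_0_iff)
  have A_add: "v + a \<in> A" if "v \<in> A" "a \<in> A" for v a
    using A_diff[OF that(1) A_diff[OF A_0 that(2)]] by simp
  have B_add: "v + a \<in> B" if "v \<in> B" "a \<in> A" for v a
    using B_diff[OF that(1), of "0 - a"] A_diff[OF A_0 that(2)] A_sub by auto
  define coset where "coset v = (\<lambda>a. v + a) ` A" for v
  have coset_sub: "coset v \<subseteq> B" if "v \<in> B" for v
    using B_add that by (auto simp: coset_def)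
  have self: "v \<in> coset v" for v
    unfolding coset_def using A_0 by (rule rev_image_eqI) simp
  have coset_eq: "coset v = coset x" if x: "x \<in> coset v" for v x
  proof -
    obtain a where a: "a \<in> A" "x = v + a" using x unfolding coset_def by auto
    show ?thesis
    proof (intro equalityI subsetI)
      fix y assume "y \<in> coset v"
      then obtain b where "b \<in> A" "y = v + b" unfolding coset_def by auto
      then show "y \<in> coset x"
        unfolding coset_def using a A_diff by (intro image_eqI[of _ _ "b - a"]) auto
    next
      fix y assume "y \<in> coset x"
      then obtain b where "b \<in> A" "y = x + b" unfolding coset_def by auto
      then show "y \<in> coset v"
        unfolding coset_def using a A_add by (intro image_eqI[of _ _ "a + b"]) (auto simp: add.assoc)
    qed
  qed
  have card_coset: "card (coset v) = card A" for v
    unfolding coset_def by (rule card_image) (auto simp: inj_on_def)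
  have "card A * card (coset ` B) = card (\<Union> (coset ` B))"
  proof (rule card_partition)
    show "finite (\<Union> (coset ` B))"
      using finB coset_sub by (meson UN_least finite_subset)
    show "X \<inter> Y = {}" if "X \<in> coset ` B" "Y \<in> coset ` B" "X \<noteq> Y" for X Y
      using that coset_eq by blast
  qed (use finB card_coset in auto)
  also have "\<Union> (coset ` B) = B" using coset_sub self by blast
  finally have "q ^ K \<le> card (coset ` B)"
    using card_le A_pos by (metis mult.commute mult_le_cancel1)
  \<comment> \<open>Keeping exactly \<open>q ^ K\<close> of the cosets makes the dimension
    exact.\<close>
  then obtain D0 where D0: "D0 \<subseteq> coset ` B" "card D0 = q ^ K" "finite D0"
    using obtain_subset_with_card_n by metis
  define D where "D = (\<lambda>X. w ` X) ` D0"
  have D0E: "\<exists>v\<in>B. X = coset v" if "X \<in> D0" for X using that D0 by blast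
  have D0_sub: "X \<subseteq> B" if "X \<in> D0" for X using D0E[OF that] coset_sub by blast
  show ?thesis
  proof (rule uniform_code_exists[where D = D and s = "card A"])
    fix C assume "C \<in> D"
    then obtain X where X: "X \<in> D0" "C = w ` X" unfolding D_def by auto
    then show "C \<subseteq> words {..<n} q" using D0_sub w_words by blast
    have "card C = card X"
      unfolding X(2) by (rule card_image, rule inj_on_subset[OF inj_w D0_sub[OF X(1)]])
    then show "card C = card A" using D0E[OF X(1)] card_coset by auto
  next
    fix C C' x assume "C \<in> D" "C' \<in> D" and x: "x \<in> C" "x \<in> C'"
    then obtain X X' where X: "X \<in> D0" "C = w ` X" "X' \<in> D0" "C' = w ` X'" unfolding D_def by auto
    from x X obtain y y' where y: "y \<in> X" "x = w y" "y' \<in> X'" "x = w y'" by blast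
    have "y = y'"
      by (rule inj_onD[OF inj_w]) (use y D0_sub[OF X(1)] D0_sub[OF X(3)] in auto)
    obtain v v' where "X = coset v" "X' = coset v'"
      using D0E[OF X(1)] D0E[OF X(3)] by blast
    then have "X = X'" using y \<open>y = y'\<close> coset_eq[of y v] coset_eq[of y v'] by simp
    then show "C = C'" using X by simp
  next
    fix S C C' x y
    assume S: "S \<subseteq> {..<n}" "card S \<le> c - 1" and C: "C \<in> D" "C' \<in> D" "x \<in> C" "y \<in> C'"
      and eq: "\<And>j. j \<notin> S \<Longrightarrow> x j = y j"
    obtain v where v: "v \<in> B" "x = w v" using C(1,3) D0_sub unfolding D_def by blast
    obtain v' where v': "v' \<in> B" "y = w v'" using C(2,4) D0_sub unfolding D_def by blast
    have "v - v' = 0"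
      by (rule dist[OF S]) (use v v' B_diff w_eqD eq in auto)
    then show "x = y" using v v' by simp
  next
    fix S assume S: "S \<subseteq> {..<n}" "card S \<le> c - 1"
    have "card {x\<in>C. restrict x S = a} = card {z\<in>A. \<forall>j\<in>S. z j = 0}"
      if C: "C \<in> D" and a: "a \<in> words S q" for C a
    proof -
      obtain X where X: "X \<in> D0" "C = w ` X" using C unfolding D_def by auto
      obtain v where v: "v \<in> B" "X = coset v" using D0E[OF X(1)] by auto
      have ga: "g (a j) \<in> g ` {..<q}" if "j \<in> S" for j
        using a that by (auto simp: words_def)
      have "\<exists>z\<in>A. \<forall>j\<in>S. z j = g (a j) - v j"
        by (rule surj[OF S]) (use ga G_diff B_val[OF v(1)] S(1) in auto)
      then obtain z where z: "z \<in> A" "\<And>j. j \<in> S \<Longrightarrow> z j = g (a j) - v j" by auto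
      \<comment> \<open>\<open>y\<close> is a representative of the same coset with the prescribed
        values on \<open>S\<close>.\<close>
      define y where "y = v + z"
      have y: "y \<in> X" "\<And>j. j \<in> S \<Longrightarrow> y j = g (a j)"
        unfolding y_def v coset_def using z by auto
      have Xy: "X = coset y" using coset_eq[of y v] y(1) v(2) by simp
      have restr: "restrict (w x) S = a \<longleftrightarrow> (\<forall>j\<in>S. x j = g (a j))" if "x \<in> X" for x
      proof -
        have xB: "x \<in> B" using that D0_sub[OF X(1)] by auto
        have "restrict (w x) S = a \<longleftrightarrow> (\<forall>j\<in>S. w x j = a j)"
          using a by (auto simp: words_def PiE_def extensional_def fun_eq_iff restrict_def)
        also have "\<dots> \<longleftrightarrow> (\<forall>j\<in>S. g (w x j) = g (a j))"
          using w_words[OF xB] a S(1) inj_on_eq_iff[OF inj]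
          by (intro ball_cong refl) (auto simp: words_def PiE_def Pi_def subset_iff)
        also have "\<dots> \<longleftrightarrow> (\<forall>j\<in>S. x j = g (a j))"
          using g_w[OF xB] S(1) by (intro ball_cong refl) (metis lessThan_iff subsetD)
        finally show ?thesis .
      qed
      have "{x\<in>C. restrict x S = a} = w ` {x\<in>X. \<forall>j\<in>S. x j = g (a j)}"
        using restr unfolding X(2) by blast
      also have "{x\<in>X. \<forall>j\<in>S. x j = g (a j)} = (\<lambda>t. y + t) ` {t\<in>A. \<forall>j\<in>S. t j = 0}"
        unfolding Xy coset_def using y(2) by auto
      also have "card (w ` \<dots>) = card ((\<lambda>t. y + t) ` {t\<in>A. \<forall>j\<in>S. t j = 0})"
        by (rule card_image, rule inj_on_subset[OF inj_w])
          (use coset_sub[of y] y(1) D0_sub[OF X(1)] in \<open>auto simp: coset_def\<close>)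
      also have "\<dots> = card {t\<in>A. \<forall>j\<in>S. t j = 0}"
        by (rule card_image) (auto simp: inj_on_def)
      finally show ?thesis .
    qed
    then show "\<exists>t. \<forall>C\<in>D. \<forall>a\<in>words S q. card {x\<in>C. restrict x S = a} = t" by blast
  next
    have "inj_on (\<lambda>X. w ` X) D0"
      by (rule inj_onI) (simp add: inj_on_image_eq_iff[OF inj_w] D0_sub)
    then show "card D = q ^ K" unfolding D_def by (simp add: card_image D0(2))
  qed (rule A_pos)
qed

subsection \<open>Fields embedded in commutative rings\<close>

text \<open>The field is the ideal generated by an idempotent \<open>e\<close> of an ambient ring,
  with \<open>e\<close> as its unit, so that it is a set that may depend on parameters. The power
  \<open>x ^ 0\<close> is the unit of the ring and need not lie in the field, which explains the
  factors \<open>e\<close> and the conditions on exponents below.\<close>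

locale embedded_field =
  fixes e :: "'a::comm_ring_1"
  assumes idem: "e * e = e" and e_neq_0: "e \<noteq> 0"
    and inverse_ex: "\<And>x. e * x = x \<Longrightarrow> x \<noteq> 0 \<Longrightarrow> \<exists>y. e * y = y \<and> x * y = e"
begin

definition F :: "'a set" where "F = {x. e * x = x}"

lemma F_simps: "x \<in> F \<Longrightarrow> e * x = x" "x \<in> F \<Longrightarrow> x * e = x"
  by (simp_all add: F_def mult.commute)

lemma F_e: "e \<in> F" and F_0: "0 \<in> F"
  by (simp_all add: F_def idem)

lemma F_mult_e: "e * x \<in> F"
  by (simp add: F_def idem flip: mult.assoc)

lemma F_add: "x \<in> F \<Longrightarrow> y \<in> F \<Longrightarrow> x + y \<in> F"
  by (simp add: F_def distrib_left)

lemma F_diff: "x \<in> F \<Longrightarrow> y \<in> F \<Longrightarrow> x - y \<in> F"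
  by (simp add: F_def right_diff_distrib)

lemma F_mult: "x \<in> F \<Longrightarrow> x * y \<in> F"
  by (simp add: F_def flip: mult.assoc)

lemma F_mult_right: "y \<in> F \<Longrightarrow> x * y \<in> F"
  using F_mult[of y x] by (simp add: mult.commute)

lemma F_sum: "(\<And>i. i \<in> I \<Longrightarrow> f i \<in> F) \<Longrightarrow> sum f I \<in> F"
  by (induction I rule: infinite_finite_induct) (auto simp: F_0 F_add)

lemma F_power: "x \<in> F \<Longrightarrow> k > 0 \<Longrightarrow> x ^ k \<in> F"
  by (cases k) (auto intro: F_mult)

lemma F_poly: "smult e f = f \<Longrightarrow> poly f x \<in> F"
  by (metis F_mult_e poly_smult)

lemma smult_e_iff: "smult e f = f \<longleftrightarrow> (\<forall>i. coeff f i \<in> F)"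
  by (auto simp: F_def poly_eq_iff)

lemma e_power_mult: "x \<in> F \<Longrightarrow> e ^ k * x = x"
  by (induction k) (simp_all add: F_simps mult.assoc)

lemma no_zero_divisors: "x \<in> F \<Longrightarrow> y \<in> F \<Longrightarrow> x * y = 0 \<Longrightarrow> x = 0 \<or> y = 0"
proof (rule ccontr)
  assume xy: "x \<in> F" "y \<in> F" "x * y = 0" "\<not> (x = 0 \<or> y = 0)"
  then obtain z where "x * z = e" using inverse_ex[of x] by (auto simp: F_def)
  then have "y = x * z * y" using xy(2) by (simp add: F_simps)
  then have "y = z * (x * y)" by (simp add: mult_ac)
  then show False using xy by simp
qed

lemma cancel: "x \<in> F \<Longrightarrow> x \<noteq> 0 \<Longrightarrow> y \<in> F \<Longrightarrow> z \<in> F \<Longrightarrow> x * y = x * z \<Longrightarrow> y = z"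
  using no_zero_divisors[of x "y - z"] F_diff[of y z] by (auto simp: right_diff_distrib)

lemma prod_neq_0:
  "(\<And>i. i \<in> I \<Longrightarrow> f i \<in> F) \<Longrightarrow> (\<And>i. i \<in> I \<Longrightarrow> f i \<noteq> 0) \<Longrightarrow> e * prod f I \<noteq> 0"
proof (induction I rule: infinite_finite_induct)
  case (insert i I)
  then have "f i * (e * prod f I) \<noteq> 0"
    using no_zero_divisors[of "f i" "e * prod f I"] F_mult_e by auto
  then show ?case using insert.hyps by (simp add: mult.left_commute)
qed (use e_neq_0 in auto)

text \<open>Linear factors are split off one at a time. The condition \<open>smult e f = f\<close>
  confines the coefficients to \<open>F\<close>, which has no zero divisors.\<close>

lemma card_roots_le:
  "f \<noteq> 0 \<Longrightarrow> smult e f = f \<Longrightarrow> finite {x\<in>F. poly f x = 0} \<and> card {x\<in>F. poly f x = 0} \<le> degree f"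
proof (induction "degree f" arbitrary: f rule: less_induct)
  case less
  show ?case
  proof (cases "\<exists>a\<in>F. poly f a = 0")
    case False
    then have *: "{x\<in>F. poly f x = 0} = {}" by auto
    show ?thesis unfolding * by simp
  next
    case True
    then obtain a where a: "a \<in> F" "poly f a = 0" by auto
    then obtain s where s: "f = [:-a, 1:] * s" by (auto simp: poly_eq_0_iff_dvd)
    \<comment> \<open>The cofactor may have coefficients outside \<open>F\<close>; multiplying it by
      \<open>e\<close> repairs this and keeps the product, as \<open>smult e f = f\<close>.\<close>
    define s' where "s' = smult e s"
    have f: "f = [:-a, 1:] * s'"
      using less.prems(2) unfolding s'_def s by simp
    have s': "s' \<noteq> 0" "smult e s' = s'"
      using less.prems(1) f by auto (simp add: s'_def idem)
    \<comment> \<open>Degrees need not add up in the ambient ring, but the linear factor is monic,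
      so the degree drops by exactly one.\<close>
    have "degree (smult (- a) s') < degree (pCons 0 s')"
      using degree_smult_le[of "-a" s'] s' by simp
    then have "degree (pCons 0 s' + smult (- a) s') = Suc (degree s')"
      using s'(1) by (subst degree_add_eq_left) auto
    then have "degree f = Suc (degree s')" by (simp add: f)
    then have IH: "finite {x\<in>F. poly s' x = 0}" "card {x\<in>F. poly s' x = 0} \<le> degree s'"
      and deg: "degree f = Suc (degree s')" using less.hyps[of s'] s' by auto
    have sub: "{x\<in>F. poly f x = 0} \<subseteq> insert a {x\<in>F. poly s' x = 0}"
    proof
      fix x assume x: "x \<in> {x\<in>F. poly f x = 0}"
      then have "(x - a) * poly s' x = 0" by (simp add: f algebra_simps)
      then show "x \<in> insert a {x\<in>F. poly s' x = 0}"
        using x a no_zero_divisors[of "x - a" "poly s' x"] F_poly[OF s'(2)] F_diff by auto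
    qed
    have "card {x\<in>F. poly f x = 0} \<le> Suc (card {x\<in>F. poly s' x = 0})"
      using card_mono[OF _ sub] IH(1) by (auto simp: card_insert_if split: if_splits)
    then show ?thesis using finite_subset[OF sub] IH deg by auto
  qed
qed

text \<open>Newton's scheme: a multiple of the polynomial vanishing on the old nodes corrects the
  value at the new node. Bounding the degree through vanishing coefficients also covers the empty
  node set.\<close>

lemma interpolation:
  assumes "finite S" "S \<subseteq> F" "\<And>s. s \<in> S \<Longrightarrow> v s \<in> F"
  shows "\<exists>P. smult e P = P \<and> (\<forall>k\<ge>card S. coeff P k = 0) \<and> (\<forall>s\<in>S. poly P s = v s)"
  using assms
proof (induction S rule: finite_induct)
  case empty
  show ?case by (rule exI[of _ 0]) auto
next
  case (insert x S)
  then obtain P where P: "smult e P = P" "\<And>k. k \<ge> card S \<Longrightarrow> coeff P k = 0"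
    "\<And>s. s \<in> S \<Longrightarrow> poly P s = v s" by auto
  define M where "M = (\<Prod>s\<in>S. [:-s, 1:])"
  have M_deg: "degree M \<le> card S"
    using degree_prod_sum_le[OF insert.hyps(1), of "\<lambda>s. [:-s, 1:]"] by (simp add: M_def)
  have M_root: "poly M s = 0" if "s \<in> S" for s
  proof -
    have "M = [:-s, 1:] * (\<Prod>s\<in>S - {s}. [:-s, 1:])"
      unfolding M_def using insert.hyps(1) that by (rule prod.remove)
    then show ?thesis by simp
  qed
  have M_x: "poly M x = (\<Prod>s\<in>S. x - s)" by (simp add: M_def poly_prod)
  have "e * poly M x \<noteq> 0"
    unfolding M_x
  proof (rule prod_neq_0)
    show "x - s \<in> F" if "s \<in> S" for s
      using that insert.prems(1) by (intro F_diff) auto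
    show "x - s \<noteq> 0" if "s \<in> S" for s
    proof
      assume "x - s = 0"
      then have "x = s" by simp
      with that insert.hyps(2) show False by simp
    qed
  qed
  \<comment> \<open>\<open>z\<close> inverts the value of \<open>M\<close> at the new node, after
    this value has been moved into \<open>F\<close> by the factor \<open>e\<close>.\<close>
  then obtain z where z: "e * poly M x * z = e" "e * z = z"
    using inverse_ex[OF F_simps(1)[OF F_mult_e]] by blast
  define c where "c = (v x - poly P x) * z"
  have c: "c \<in> F" unfolding c_def using z(2) by (intro F_mult_right) (simp add: F_def)
  have vx: "v x \<in> F" using insert.prems by auto
  have "c * poly M x = (v x - poly P x) * (e * z) * poly M x"
    by (simp add: c_def z(2))
  also have "\<dots> = (v x - poly P x) * (e * poly M x * z)" by (simp add: mult_ac)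
  also have "\<dots> = v x - poly P x"
    using F_diff[OF vx F_poly[OF P(1)]] by (simp add: z F_simps)
  finally have cM: "c * poly M x = v x - poly P x" .
  show ?case
  proof (intro exI[of _ "P + smult c M"] conjI allI impI ballI)
    show "smult e (P + smult c M) = P + smult c M"
      using P(1) c by (simp add: smult_add_right F_simps)
    show "coeff (P + smult c M) k = 0" if "k \<ge> card (insert x S)" for k
      using that P(2)[of k] M_deg insert.hyps by (simp add: coeff_eq_0)
    show "poly (P + smult c M) s = v s" if "s \<in> insert x S" for s
      using that cM P(3) M_root by auto
  qed
qed

end

section \<open>Characteristic \<open>p\<close> and the Frobenius map\<close>

locale embedded_field_char = embedded_field +
  fixes p :: nat
  assumes prime_p: "prime p" and char_p: "of_nat p * e = 0"
begin

text \<open>The inner binomial coefficients are multiples of \<open>p\<close>, and these kill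
  \<open>F\<close> because they kill its unit \<open>e\<close>; the ambient ring may have another
  characteristic.\<close>

lemma frobenius_add1:
  assumes x: "x \<in> F" and y: "y \<in> F"
  shows "(x + y) ^ p = x ^ p + y ^ p"
proof -
  have p: "p > 0" using prime_p prime_gt_0_nat by blast
  have mid: "of_nat (p choose k) * x ^ k * y ^ (p - k) = 0" if k: "k \<noteq> 0" "k < p" for k
  proof -
    obtain d where d: "p choose k = p * d"
      using dvd_choose_prime[of k p] k prime_p by (auto simp: dvd_def)
    have "x ^ k \<in> F" using x k F_power by auto
    then have "of_nat (p choose k) * x ^ k * y ^ (p - k) = of_nat (p * d) * (e * x ^ k) * y ^ (p - k)"
      by (simp only: d F_simps)
    also have "\<dots> = (of_nat p * e) * (of_nat d * x ^ k * y ^ (p - k))"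
      by (simp only: of_nat_mult mult_ac)
    finally show ?thesis unfolding char_p by simp
  qed
  have "(x + y) ^ p = (\<Sum>k\<le>p. of_nat (p choose k) * x ^ k * y ^ (p - k))"
    by (simp add: binomial_ring)
  also have "\<dots> = (\<Sum>k\<in>{0, p}. of_nat (p choose k) * x ^ k * y ^ (p - k))"
    by (rule sum.mono_neutral_right) (use mid in auto)
  also have "\<dots> = x ^ p + y ^ p" using p by simp
  finally show ?thesis .
qed

lemma frobenius_add:
  assumes "x \<in> F" "y \<in> F"
  shows "(x + y) ^ (p ^ k) = x ^ (p ^ k) + y ^ (p ^ k)"
proof (induction k)
  case (Suc k)
  have p: "p ^ k > 0" using prime_p prime_gt_0_nat by simp
  show ?case using Suc frobenius_add1[of "x ^ (p ^ k)" "y ^ (p ^ k)"] F_power[OF _ p] assms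
    by (simp add: power_mult mult.commute[of p])
qed simp

lemma frobenius_sum:
  assumes "\<And>i. i \<in> I \<Longrightarrow> f i \<in> F"
  shows "(\<Sum>i\<in>I. f i) ^ (p ^ k) = (\<Sum>i\<in>I. f i ^ (p ^ k))"
  using assms
proof (induction I rule: infinite_finite_induct)
  case (insert x I)
  then show ?case using frobenius_add[of "f x" "sum f I" k] F_sum[of I f] by simp
qed (use prime_p in \<open>auto simp: prime_gt_0_nat power_0_left\<close>)

end

subsection \<open>Existence of finite fields\<close>

definition ring_ideal :: "'a::comm_ring_1 set \<Rightarrow> bool" where
  "ring_ideal I \<longleftrightarrow> 0 \<in> I \<and> (\<forall>x\<in>I. \<forall>y\<in>I. x + y \<in> I) \<and> (\<forall>x\<in>I. \<forall>r. r * x \<in> I)"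

lemma
  assumes "ring_ideal I"
  shows ideal_0: "0 \<in> I" and ideal_add: "x \<in> I \<Longrightarrow> y \<in> I \<Longrightarrow> x + y \<in> I"
    and ideal_mult: "x \<in> I \<Longrightarrow> r * x \<in> I"
    and ideal_uminus: "x \<in> I \<Longrightarrow> - x \<in> I" and ideal_diff: "x \<in> I \<Longrightarrow> y \<in> I \<Longrightarrow> x - y \<in> I"
proof -
  show *: "0 \<in> I" "x \<in> I \<Longrightarrow> y \<in> I \<Longrightarrow> x + y \<in> I" "x \<in> I \<Longrightarrow> r * x \<in> I" for x y r
    using assms by (auto simp: ring_ideal_def)
  show m: "x \<in> I \<Longrightarrow> - x \<in> I" for x using *(3)[of x "-1"] by simp
  show "x \<in> I \<Longrightarrow> y \<in> I \<Longrightarrow> x - y \<in> I" using *(2)[of x "-y"] m by simp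
qed

lemma ideal_diff_cong:
  assumes "ring_ideal I" "x - x' \<in> I" "y - y' \<in> I"
  shows "(x - y) - (x' - y') \<in> I"
  using ideal_diff[OF assms] by (simp add: algebra_simps)

lemma ideal_mult_cong:
  assumes I: "ring_ideal I" "x - x' \<in> I" "y - y' \<in> I"
  shows "x * y - x' * y' \<in> I"
  using ideal_add[OF I(1) ideal_mult[OF I(1,3), of x] ideal_mult[OF I(1,2), of y']]
  by (simp add: algebra_simps)

lemma maximal_ideal_exists:
  assumes I: "ring_ideal I" "1 \<notin> I"
  shows "\<exists>P. ring_ideal P \<and> I \<subseteq> P \<and> 1 \<notin> P \<and> (\<forall>x. x \<notin> P \<longrightarrow> (\<exists>y. x * y - 1 \<in> P))"
proof -
  define \<A> where "\<A> = {J. ring_ideal J \<and> I \<subseteq> J \<and> 1 \<notin> J}"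
  have "\<exists>M\<in>\<A>. \<forall>X\<in>\<A>. M \<subseteq> X \<longrightarrow> X = M"
  proof (rule subset_Zorn_nonempty)
    show "\<A> \<noteq> {}" using I by (auto simp: \<A>_def)
    fix \<C> assume ne: "\<C> \<noteq> {}" and ch: "subset.chain \<A> \<C>"
    have sub: "J \<in> \<A>" if "J \<in> \<C>" for J using ch that by (auto simp: subset.chain_def)
    have "x + y \<in> \<Union>\<C>" if xy: "x \<in> \<Union>\<C>" "y \<in> \<Union>\<C>" for x y
    proof -
      obtain J K where JK: "x \<in> J" "y \<in> K" "J \<in> \<C>" "K \<in> \<C>" using xy by blast
      then have "J \<subseteq> K \<or> K \<subseteq> J" using ch by (auto simp: subset.chain_def)
      moreover have "ring_ideal J" "ring_ideal K" using sub JK by (auto simp: \<A>_def)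
      ultimately have "x + y \<in> J \<or> x + y \<in> K" using JK ideal_add by blast
      then show ?thesis using JK by blast
    qed
    moreover have "0 \<in> \<Union>\<C>" using ne sub ideal_0 unfolding \<A>_def by blast
    moreover have "r * x \<in> \<Union>\<C>" if "x \<in> \<Union>\<C>" for x r
      using that sub ideal_mult unfolding \<A>_def by blast
    ultimately have "ring_ideal (\<Union>\<C>)" unfolding ring_ideal_def by blast
    then show "\<Union>\<C> \<in> \<A>" using ne sub unfolding \<A>_def by blast
  qed
  then obtain P where P: "P \<in> \<A>" and max: "\<And>X. X \<in> \<A> \<Longrightarrow> P \<subseteq> X \<Longrightarrow> X = P" by blast
  have id: "ring_ideal P" "I \<subseteq> P" "1 \<notin> P" using P by (auto simp: \<A>_def)
  have "\<exists>y. x * y - 1 \<in> P" if x: "x \<notin> P" for x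
  proof -
    \<comment> \<open>\<open>J\<close> is the ideal generated by \<open>P\<close> and
      \<open>x\<close>; as it is strictly larger than \<open>P\<close>, maximality forces
      \<open>1\<close> into it.\<close>
    define J where "J = {a. \<exists>y. a - x * y \<in> P}"
    have "ring_ideal J"
      unfolding ring_ideal_def
    proof (intro conjI ballI allI)
      show "0 \<in> J" unfolding J_def using ideal_0[OF id(1)] by (auto intro: exI[of _ 0])
    next
      fix a b assume "a \<in> J" "b \<in> J"
      then obtain y z where "a - x * y \<in> P" "b - x * z \<in> P" by (auto simp: J_def)
      from ideal_add[OF id(1) this] have "a + b - x * (y + z) \<in> P" by (simp add: algebra_simps)
      then show "a + b \<in> J" by (auto simp: J_def)
    next
      fix a r assume "a \<in> J"
      then obtain y where "a - x * y \<in> P" by (auto simp: J_def)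
      from ideal_mult[OF id(1) this, of r] have "r * a - x * (r * y) \<in> P" by (simp add: algebra_simps)
      then show "r * a \<in> J" by (auto simp: J_def)
    qed
    moreover have "P \<subseteq> J" by (auto simp: J_def intro: exI[of _ 0])
    moreover have "x \<in> J" by (auto simp: J_def ideal_0[OF id(1)] intro: exI[of _ 1])
    ultimately have "1 \<in> J" using max[of J] x id(2) by (auto simp: \<A>_def)
    then obtain y where "1 - x * y \<in> P" by (auto simp: J_def)
    from ideal_uminus[OF id(1) this] show ?thesis by auto
  qed
  then show ?thesis using id by blast
qed

\<comment> \<open>The product of all quotient rings\<close>
text \<open>
  The fields needed below depend on \<open>p\<close> and \<open>r\<close>, and no type can depend on a variable. Every quotient
  ring of \<open>'a\<close> is however a direct factor of the product of all quotient rings of \<open>'a\<close>.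
\<close>

quotient_type (overloaded) 'a quotients = "'a::comm_ring_1 set \<Rightarrow> 'a" /
  "\<lambda>f g. \<forall>I. ring_ideal I \<longrightarrow> f I - g I \<in> I"
proof (rule equivpI)
  show "reflp (\<lambda>f g :: 'a set \<Rightarrow> 'a. \<forall>I. ring_ideal I \<longrightarrow> f I - g I \<in> I)"
    by (auto intro!: reflpI ideal_0)
  show "symp (\<lambda>f g :: 'a set \<Rightarrow> 'a. \<forall>I. ring_ideal I \<longrightarrow> f I - g I \<in> I)"
    by (auto intro!: sympI) (metis ideal_uminus minus_diff_eq)
  show "transp (\<lambda>f g :: 'a set \<Rightarrow> 'a. \<forall>I. ring_ideal I \<longrightarrow> f I - g I \<in> I)"
  proof (rule transpI, intro allI impI)
    fix f g h :: "'a set \<Rightarrow> 'a" and I :: "'a set"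
    assume "\<forall>I. ring_ideal I \<longrightarrow> f I - g I \<in> I" "\<forall>I. ring_ideal I \<longrightarrow> g I - h I \<in> I" "ring_ideal I"
    then show "f I - h I \<in> I" using ideal_add[of I "f I - g I" "g I - h I"] by simp
  qed
qed

instantiation quotients :: (comm_ring_1) comm_ring_1
begin

lift_definition zero_quotients :: "'a quotients" is "\<lambda>_. 0" .
lift_definition one_quotients :: "'a quotients" is "\<lambda>_. 1" .
lift_definition uminus_quotients :: "'a quotients \<Rightarrow> 'a quotients" is "\<lambda>f I. - f I"
  by (metis ideal_uminus minus_diff_eq minus_diff_minus)
lift_definition plus_quotients :: "'a quotients \<Rightarrow> 'a quotients \<Rightarrow> 'a quotients" is "\<lambda>f g I. f I + g I"
  by (metis ideal_add add_diff_add)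
lift_definition minus_quotients :: "'a quotients \<Rightarrow> 'a quotients \<Rightarrow> 'a quotients" is "\<lambda>f g I. f I - g I"
  by (blast intro: ideal_diff_cong)
lift_definition times_quotients :: "'a quotients \<Rightarrow> 'a quotients \<Rightarrow> 'a quotients" is "\<lambda>f g I. f I * g I"
  by (blast intro: ideal_mult_cong)

instance
proof
  \<comment> \<open>The factor at the zero ideal is the ring itself, where \<open>0\<close> and
    \<open>1\<close> differ.\<close>
  have "ring_ideal {0::'a}" by (simp add: ring_ideal_def)
  then show "(0 :: 'a quotients) \<noteq> 1"
    by transfer (auto intro!: exI[of _ "{0}"])
qed (transfer; simp add: ideal_0 algebra_simps)+

end

text \<open>The quotient by an ideal \<open>I\<close> as a direct factor: the component at
  \<open>I\<close> carries \<open>x\<close>, all others are \<open>0\<close>. The map is additive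
  and multiplicative but sends \<open>1\<close> to an idempotent, the unit of this factor.\<close>

lift_definition in_quotient :: "'a::comm_ring_1 set \<Rightarrow> 'a \<Rightarrow> 'a quotients" is
  "\<lambda>I x J. if J = I then x else 0" .

lemma in_quotient_add: "in_quotient I (x + y) = in_quotient I x + in_quotient I y"
  and in_quotient_mult: "in_quotient I (x * y) = in_quotient I x * in_quotient I y"
  and in_quotient_0: "in_quotient I 0 = 0"
  by (transfer; simp add: ideal_0)+

lemma in_quotient_eq_iff: "ring_ideal I \<Longrightarrow> in_quotient I x = in_quotient I y \<longleftrightarrow> x - y \<in> I"
  by transfer (auto simp: ideal_0)

lemma in_quotient_surj: "in_quotient I 1 * y = y \<Longrightarrow> \<exists>x. y = in_quotient I x"
proof transfer
  fix I and f :: "'a set \<Rightarrow> 'a"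
  assume *: "\<forall>J. ring_ideal J \<longrightarrow> (if J = I then 1 else 0) * f J - f J \<in> J"
  have "f J - (if J = I then f I else 0) \<in> J" if "ring_ideal J" for J
    using that *[rule_format, of J] ideal_0[of J] ideal_uminus[of J "- f J"]
    by (cases "J = I") auto
  then show "\<exists>x. \<forall>J. ring_ideal J \<longrightarrow> f J - (if J = I then x else 0) \<in> J" by blast
qed

lemma embedded_field_quotient:
  assumes P: "ring_ideal P" "1 \<notin> P" and inv: "\<And>x. x \<notin> P \<Longrightarrow> \<exists>y. x * y - 1 \<in> P"
  shows "embedded_field (in_quotient P 1)"
proof
  show "in_quotient P 1 * in_quotient P 1 = in_quotient P 1"
    by (simp flip: in_quotient_mult)
  show "in_quotient P 1 \<noteq> 0"
    unfolding in_quotient_0[of P, symmetric] in_quotient_eq_iff[OF P(1)] using P by simp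
  fix a assume a: "in_quotient P 1 * a = a" "a \<noteq> 0"
  obtain x where x: "a = in_quotient P x" using in_quotient_surj[OF a(1)] by blast
  have "x \<notin> P"
    using a(2) unfolding x in_quotient_0[of P, symmetric] in_quotient_eq_iff[OF P(1)] by simp
  then obtain y where y: "x * y - 1 \<in> P" using inv by blast
  show "\<exists>b. in_quotient P 1 * b = b \<and> a * b = in_quotient P 1"
    using y by (intro exI[of _ "in_quotient P y"])
      (simp add: x in_quotient_eq_iff[OF P(1)] flip: in_quotient_mult)
qed

section \<open>Cyclotomic integers modulo a prime, and finite fields\<close>

text \<open>
  Multiplication by \<open>p * g(\<zeta>)\<close> is given on the powers of \<open>\<zeta>\<close> by an integer matrix
  \<open>M\<close> with entries divisible by \<open>p\<close>, so \<open>det (1 - M)\<close> is \<open>1\<close> modulo \<open>p\<close>.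
\<close>

lemma prime_not_unit_cyclotomic:
  fixes \<zeta> :: complex and g :: "int poly"
  assumes p: "p > 1" and n: "n > 0" and \<zeta>: "\<zeta> ^ n = 1"
  shows "of_nat p * poly (map_poly of_int g) \<zeta> \<noteq> 1"
proof
  assume eq: "of_nat p * poly (map_poly of_int g) \<zeta> = 1"
  \<comment> \<open>As \<open>\<zeta> ^ n = 1\<close>, exponents can be reduced modulo
    \<open>n\<close>, so the first \<open>n\<close> powers of \<zeta> span all values over the
    integers.\<close>
  have "\<exists>c :: nat \<Rightarrow> int. poly (map_poly of_int h) \<zeta> = (\<Sum>j<n. of_int (c j) * \<zeta> ^ j)" for h :: "int poly"
  proof -
    have "poly (map_poly of_int h) \<zeta> = (\<Sum>k\<le>degree h. of_int (coeff h k) * \<zeta> ^ k)"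
      by (simp add: poly_altdef degree_map_poly coeff_map_poly)
    also have "\<dots> = (\<Sum>j<n. \<Sum>k\<in>{k\<in>{..degree h}. k mod n = j}. of_int (coeff h k) * \<zeta> ^ k)"
      by (rule sum.group[symmetric]) (use n in auto)
    also have "\<dots> = (\<Sum>j<n. of_int (\<Sum>k\<in>{k\<in>{..degree h}. k mod n = j}. coeff h k) * \<zeta> ^ j)"
    proof (rule sum.cong)
      fix j
      have "\<zeta> ^ k = \<zeta> ^ (k mod n)" for k
        by (metis \<zeta> div_mult_mod_eq mult.commute mult_1 power_add power_mult power_one)
      then have "(\<Sum>k\<in>{k\<in>{..degree h}. k mod n = j}. of_int (coeff h k) * \<zeta> ^ k) =
        (\<Sum>k\<in>{k\<in>{..degree h}. k mod n = j}. of_int (coeff h k) * \<zeta> ^ j)"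
        by (intro sum.cong) auto
      then show "(\<Sum>k\<in>{k\<in>{..degree h}. k mod n = j}. of_int (coeff h k) * \<zeta> ^ k) =
        of_int (\<Sum>k\<in>{k\<in>{..degree h}. k mod n = j}. coeff h k) * \<zeta> ^ j"
        by (simp add: sum_distrib_right)
    qed simp
    finally show ?thesis
      by (intro exI[of _ "\<lambda>j. \<Sum>k\<in>{k\<in>{..degree h}. k mod n = j}. coeff h k"])
  qed
  then have "\<forall>i. \<exists>c :: nat \<Rightarrow> int. poly (map_poly of_int (g * monom 1 i)) \<zeta> = (\<Sum>j<n. of_int (c j) * \<zeta> ^ j)"
    by blast
  then obtain c :: "nat \<Rightarrow> nat \<Rightarrow> int"
    where "\<And>i. poly (map_poly of_int (g * monom 1 i)) \<zeta> = (\<Sum>j<n. of_int (c i j) * \<zeta> ^ j)"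
    by metis
  then have c: "poly (map_poly of_int g) \<zeta> * \<zeta> ^ i = (\<Sum>j<n. of_int (c i j) * \<zeta> ^ j)" for i
    by (metis (no_types, lifting) of_int_poly_hom.hom_mult poly_mult map_poly_monom of_int_0 of_int_1
        poly_monom mult_1)
  \<comment> \<open>This \<open>M\<close> is the identity minus the matrix of multiplication by
    \<open>p * g(\<zeta>)\<close>. As that number is assumed to be \<open>1\<close>, it annihilates
    the nonzero vector of powers of \<zeta>, whereas its determinant is \<open>1\<close> modulo
    \<open>p\<close>.\<close>
  define M where "M = mat n n (\<lambda>(i, j). (if i = j then 1 else 0) - int p * c i j)"
  have M: "M \<in> carrier_mat n n" by (simp add: M_def)
  have "[det M = det (1\<^sub>m n)] (mod int p)"
    unfolding det_def'[OF M] det_def'[OF one_carrier_mat]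
  proof (intro cong_sum cong_mult cong_prod cong_refl)
    fix \<pi> i assume "\<pi> \<in> {\<pi>. \<pi> permutes {0..<n}}" "i \<in> {0..<n}"
    then have "i < n" "\<pi> i < n" using permutes_in_image[of \<pi> "{0..<n}" i] by auto
    then show "[M $$ (i, \<pi> i) = 1\<^sub>m n $$ (i, \<pi> i)] (mod int p)"
      by (simp add: M_def cong_iff_dvd_diff)
  qed
  then have det1: "[det M = 1] (mod int p)" by simp
  define v where "v = vec n (\<lambda>i. \<zeta> ^ i)"
  have "map_mat complex_of_int M *\<^sub>v v = 0\<^sub>v n"
  proof (rule eq_vecI)
    fix i assume "i < dim_vec (0\<^sub>v n :: complex vec)"
    then have i: "i < n" by simp
    have "(map_mat complex_of_int M *\<^sub>v v) $ i =
        (\<Sum>j<n. ((if i = j then 1 else 0) - of_nat p * of_int (c i j)) * \<zeta> ^ j)"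
      using i by (auto simp: M_def v_def scalar_prod_def atLeast0LessThan intro!: sum.cong)
    also have "\<dots> = (\<Sum>j<n. (if i = j then \<zeta> ^ i else 0)) - of_nat p * (\<Sum>j<n. of_int (c i j) * \<zeta> ^ j)"
      unfolding sum_distrib_left sum_subtractf[symmetric] by (rule sum.cong) (auto simp: algebra_simps)
    also have "\<dots> = \<zeta> ^ i - (of_nat p * poly (map_poly of_int g) \<zeta>) * \<zeta> ^ i"
      using i by (simp add: c[symmetric] mult.assoc)
    also have "\<dots> = 0" using eq by simp
    finally show "(map_mat complex_of_int M *\<^sub>v v) $ i = 0\<^sub>v n $ i" using i by simp
  qed (simp add: M_def)
  moreover have "v \<noteq> 0\<^sub>v n"
  proof
    assume "v = 0\<^sub>v n"
    then have "v $ 0 = 0\<^sub>v n $ 0" by simp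
    then show False using n by (simp add: v_def)
  qed
  moreover have "v \<in> carrier_vec n" "map_mat complex_of_int M \<in> carrier_mat n n"
    using M by (auto simp: v_def)
  ultimately have "det (map_mat complex_of_int M) = 0"
    using det_0_iff_vec_prod_zero_field by blast
  then have "det M = 0" by (simp add: of_int_hom.hom_det)
  then have "int p dvd 1" using det1 by (simp add: cong_iff_dvd_diff)
  then show False using p by simp
qed

lemma in_quotient_of_nat: "in_quotient I (of_nat k) = of_nat k * in_quotient I 1"
  by (induction k) (simp_all add: in_quotient_0 in_quotient_add distrib_right)

lemma in_quotient_sum: "in_quotient I (sum f A) = (\<Sum>a\<in>A. in_quotient I (f a))"
  by (induction A rule: infinite_finite_induct) (simp_all add: in_quotient_0 in_quotient_add)

lemma primitive_root_of_unity_exists: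
  assumes "n > 0"
  shows "\<exists>\<zeta>::complex. \<zeta> ^ n = 1 \<and> (\<forall>k. 0 < k \<and> k < n \<longrightarrow> \<zeta> ^ k \<noteq> 1)"
proof (intro exI[of _ "cis (2 * pi / n)"] conjI allI impI)
  show "cis (2 * pi / n) ^ n = 1" using assms by (simp add: Complex.DeMoivre)
  fix k assume k: "0 < k \<and> k < n"
  show "cis (2 * pi / n) ^ k \<noteq> 1"
  proof
    assume "cis (2 * pi / n) ^ k = 1"
    then have "cos (2 * pi * (k / n)) = 1"
      by (simp add: Complex.DeMoivre complex_eq_iff mult_ac)
    then obtain i :: int where "2 * pi * (k / n) = of_int i * 2 * pi" by (auto simp: cos_one_2pi_int)
    then have "real k = of_int (i * int n)" using assms by (simp add: field_simps)
    then have "int k = i * int n" by linarith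
    then have "int n dvd int k" by simp
    then show False using k dvd_imp_le[of n k] by auto
  qed
qed

text \<open>Adjoin to the integers a primitive root of unity \<zeta> of order
  \<open>p ^ r - 1\<close> and divide by a maximal ideal containing \<open>p\<close>. The class of
  \<zeta> keeps its order, which gives at least \<open>p ^ r\<close> elements; all elements are
  roots of \<open>y ^ (p ^ r) - y\<close>, which gives at most as many.\<close>

lemma finite_embedded_field_exists:
  assumes p: "prime p" and r: "r > 0"
  shows "\<exists>e :: int poly quotients. embedded_field_char e p \<and> finite (embedded_field.F e) \<and>
    card (embedded_field.F e) = p ^ r"
proof -
  define N where "N = p ^ r"
  define n where "n = N - 1"
  have N: "N > 1" using one_less_power[OF prime_gt_1_nat[OF p] r] unfolding N_def .
  then have n: "n > 0" "Suc n = N" by (auto simp: n_def)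
  obtain \<zeta> :: complex where \<zeta>: "\<zeta> ^ n = 1" "\<And>k. 0 < k \<Longrightarrow> k < n \<Longrightarrow> \<zeta> ^ k \<noteq> 1"
    using primitive_root_of_unity_exists[OF n(1)] by blast
  define ev :: "int poly \<Rightarrow> complex" where "ev f = poly (map_poly of_int f) \<zeta>" for f
  have ev_simps: "ev (f + g) = ev f + ev g" "ev (f * g) = ev f * ev g" "ev 0 = 0" "ev 1 = 1"
    "ev (f - g) = ev f - ev g" "ev (of_nat k) = of_nat k" "ev (monom 1 k) = \<zeta> ^ k"
    "ev (sum h A) = (\<Sum>a\<in>A. ev (h a))" for f g k A and h :: "nat \<Rightarrow> int poly"
    unfolding ev_def
    by (simp_all add: of_int_poly_hom.hom_add of_int_poly_hom.hom_mult of_int_poly_hom.hom_minus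
        of_int_poly_hom.hom_sum map_poly_monom poly_monom poly_sum of_int_poly_hom.hom_of_nat)
  \<comment> \<open>The preimage of the multiples of \<open>p\<close> under evaluation at \<zeta>;
    it is a proper ideal because \<open>p\<close> is not a unit in the ring generated by
    \<zeta>.\<close>
  define I where "I = {f. \<exists>g. ev f = of_nat p * ev g}"
  have "ring_ideal I"
    unfolding ring_ideal_def
  proof (intro conjI ballI allI)
    show "0 \<in> I" unfolding I_def by (auto simp: ev_simps intro: exI[of _ 0])
    show "f + g \<in> I" if "f \<in> I" "g \<in> I" for f g
      using that unfolding I_def by (auto simp: ev_simps) (metis distrib_left ev_simps(1))
    show "f * g \<in> I" if "g \<in> I" for f g
      using that unfolding I_def by (auto simp: ev_simps) (metis mult.left_commute ev_simps(2))
  qed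
  moreover have "1 \<notin> I"
    using prime_not_unit_cyclotomic[OF prime_gt_1_nat[OF p] n(1) \<zeta>(1)]
    unfolding I_def by (auto simp: ev_simps) (metis ev_def)
  ultimately obtain P where P: "ring_ideal P" "I \<subseteq> P" "1 \<notin> P" "\<And>x. x \<notin> P \<Longrightarrow> \<exists>y. x * y - 1 \<in> P"
    using maximal_ideal_exists by metis
  define e where "e = in_quotient P 1"
  have zero: "in_quotient P f = 0" if "ev f = of_nat p * ev g" for f g
    unfolding in_quotient_0[of P, symmetric] in_quotient_eq_iff[OF P(1)]
    using that P(2) by (auto simp: I_def)
  interpret embedded_field e
    unfolding e_def by (rule embedded_field_quotient[OF P(1,3,4)])
  have char: "of_nat p * e = 0"
    unfolding e_def in_quotient_of_nat[symmetric] by (rule zero[of _ 1]) (simp add: ev_simps)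
  interpret embedded_field_char e p
    by unfold_locales (use p char in auto)
  have F_eq: "F = range (in_quotient P)"
  proof (intro equalityI subsetI)
    show "y \<in> range (in_quotient P)" if "y \<in> F" for y
      using in_quotient_surj[of P y] F_simps(1)[OF that] by (auto simp: e_def)
    show "y \<in> F" if "y \<in> range (in_quotient P)" for y
      using that unfolding F_def by (auto simp: e_def[symmetric])
        (simp add: e_def flip: in_quotient_mult)
  qed
  define X where "X k = in_quotient P (monom 1 k)" for k
  have X_0: "X 0 = e" by (simp add: X_def e_def)
  have X_add: "X (i + j) = X i * X j" for i j
    unfolding X_def by (simp add: mult_monom flip: in_quotient_mult)
  have X_F: "X i \<in> F" for i unfolding F_eq X_def by blast
  have "in_quotient P (monom 1 n - 1) = 0"
    by (rule zero[of _ 0]) (simp add: ev_simps \<zeta>)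
  then have X_n: "X n = e"
    unfolding X_def e_def in_quotient_0[of P, symmetric] in_quotient_eq_iff[OF P(1)] by simp
  have X_mult: "X (n * k) = e" for k
    by (induction k) (simp_all add: X_0 X_add X_n idem)
  \<comment> \<open>If \<open>\<zeta> ^ k\<close> became the unit, the geometric sum over its
    powers, which vanishes in the complex numbers, would become \<open>n\<close> times the unit; but
    \<open>n\<close> is \<open>-1\<close> modulo \<open>p\<close>.\<close>
  have X_ne: "X k \<noteq> e" if k: "0 < k" "k < n" for k
  proof
    assume Xk: "X k = e"
    have Xkl: "X (k * l) = e" for l
      by (induction l) (simp_all add: X_0 X_add Xk idem)
    have "(\<zeta> ^ k) ^ n = 1" by (metis \<zeta>(1) mult.commute power_mult power_one)
    then have "(\<Sum>l<n. (\<zeta> ^ k) ^ l) = 0"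
      using \<zeta>(2)[OF k] geometric_sum[of "\<zeta> ^ k" n] by simp
    then have "ev (\<Sum>l<n. monom 1 (k * l)) = of_nat p * ev 0"
      by (simp add: ev_simps power_mult)
    then have "in_quotient P (\<Sum>l<n. monom 1 (k * l)) = 0" by (rule zero)
    then have "of_nat n * e = 0"
      using Xkl by (simp add: in_quotient_sum flip: X_def)
    then have "of_nat N * e = e" by (simp add: distrib_right flip: n(2))
    moreover have "of_nat N * e = of_nat (p ^ (r - 1)) * (of_nat p * e)"
      unfolding N_def using r by (cases r) (simp_all add: mult_ac)
    ultimately show False using char e_neq_0 by simp
  qed
  have X_neq_0: "X i \<noteq> 0" if "i < n" for i
  proof
    assume "X i = 0"
    then have "X (i + (n - i)) = 0" unfolding X_add by simp
    then show False using that X_n e_neq_0 by simp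
  qed
  have X_less: "X i \<noteq> X j" if ij: "i < j" "j < n" for i j
  proof
    assume "X i = X j"
    then have "X (i + (n - i)) = X (j + (n - i))" by (simp only: X_add)
    also have "j + (n - i) = (j - i) + n" using ij by simp
    finally have "X n = X (j - i + n)" using ij by simp
    then have "X n = X (j - i) * X n" by (simp only: X_add)
    then have "X (j - i) = e" using X_F[of "j - i"] by (simp add: X_n F_simps)
    then show False using X_ne[of "j - i"] ij by simp
  qed
  then have inj: "inj_on X {..<n}"
    by (auto simp: inj_on_def) (metis nat_neq_iff)
  have X_N: "X k ^ N = X k" for k
  proof -
    have "X (k * l) = (if l = 0 then e else X k ^ l)" for l
      by (induction l) (auto simp: X_0 X_add X_F F_simps)
    from this[of N] have "X k ^ N = X (k + n * k)" using N by (simp flip: n(2) add: mult.commute)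
    also have "\<dots> = X k" by (simp only: X_add X_mult F_simps X_F)
    finally show ?thesis .
  qed
  \<comment> \<open>The elements fixed by the \<open>N\<close>-th power are closed under addition
    (by Frobenius) and multiplication, and contain the integer constants and the class
    \<open>X 1\<close> of \<zeta>, which generate \<open>F\<close>.\<close>
  have powN: "y ^ N = y" if "y \<in> F" for y
  proof -
    have add: "(x + y) ^ N = x + y" if "x \<in> F" "y \<in> F" "x ^ N = x" "y ^ N = y" for x y
      using that frobenius_add[of x y r] by (simp add: N_def)
    have c: "(of_nat k * e) ^ N = of_nat k * e" for k
    proof (induction k)
      case 0
      then show ?case using N by (simp add: power_0_left)
    next
      case (Suc k)
      then show ?case
        using add[of e "of_nat k * e"] X_N[of 0] F_e F_mult_right[OF F_e] by (simp add: X_0 distrib_right)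
    qed
    have const: "in_quotient P [:a:] ^ N = in_quotient P [:a:]" for a
    proof -
      have p0: "int p > 0" using p prime_gt_0_nat by simp
      define k where "k = nat (a mod int p)"
      have "a = int k + int p * (a div int p)" using p0 by (simp add: k_def)
      then have "[:a:] = of_nat k + of_nat p * [:a div int p:]"
        by (simp add: of_nat_poly mult.commute)
      then have "in_quotient P [:a:] = of_nat k * e + in_quotient P (of_nat p) * in_quotient P [:a div int p:]"
        by (simp only: in_quotient_add in_quotient_mult in_quotient_of_nat flip: e_def)
      also have "in_quotient P (of_nat p) = 0"
        using char by (simp add: in_quotient_of_nat flip: e_def)
      finally show ?thesis using c by simp
    qed
    have "in_quotient P f ^ N = in_quotient P f" for f
    proof (induction f)
      case 0
      then show ?case using N by (simp add: in_quotient_0 power_0_left)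
    next
      case (pCons a f)
      have "pCons a f = [:a:] + monom 1 1 * f" by (simp add: monom_altdef)
      then have "in_quotient P (pCons a f) = in_quotient P [:a:] + X 1 * in_quotient P f"
        by (simp only: in_quotient_add in_quotient_mult X_def)
      then show ?case
        using add[OF _ _ const[of a], of "X 1 * in_quotient P f"] X_N[of 1] pCons.IH X_F[of 1]
        by (simp add: power_mult_distrib F_eq F_mult) (metis F_eq F_mult)
    qed
    then show ?thesis using that F_eq by auto
  qed
  define f where "f = monom e N - monom e 1"
  have "coeff f N = e" using N by (simp add: f_def)
  then have "f \<noteq> 0" using e_neq_0 by auto
  moreover have "smult e f = f" by (simp add: f_def smult_diff_right smult_monom idem)
  ultimately have "finite {x\<in>F. poly f x = 0} \<and> card {x\<in>F. poly f x = 0} \<le> degree f"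
    by (rule card_roots_le)
  moreover have "{x\<in>F. poly f x = 0} = F"
    using powN by (auto simp: f_def poly_monom)
  moreover have "degree f \<le> N"
    unfolding f_def using N by (intro degree_diff_le) (auto intro: order.trans[OF degree_monom_le])
  ultimately have fin: "finite F" and le: "card F \<le> N" by auto
  have "N = card (insert 0 (X ` {..<n}))"
    using X_neq_0 n by (subst card_insert_disjoint) (auto simp: card_image[OF inj])
  also have "\<dots> \<le> card F"
    by (rule card_mono[OF fin]) (use X_F F_0 in auto)
  finally have "card F = p ^ r" using le by (simp add: N_def)
  then show ?thesis using fin embedded_field_char_axioms by blast
qed

subsection \<open>Frobenius and trace\<close>

lemma card_le_image_times_kernel:
  fixes f :: "'a::ab_group_add \<Rightarrow> 'b::ab_group_add"
  assumes fin: "finite V" and diff: "\<And>x y. x \<in> V \<Longrightarrow> y \<in> V \<Longrightarrow> x - y \<in> V"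
    and hom: "\<And>x y. x \<in> V \<Longrightarrow> y \<in> V \<Longrightarrow> f (x - y) = f x - f y"
  shows "card V \<le> card (f ` V) * card {v\<in>V. f v = 0}"
proof -
  have fiber: "card {v\<in>V. f v = y} \<le> card {v\<in>V. f v = 0}" if y: "y \<in> f ` V" for y
  proof -
    obtain v0 where v0: "v0 \<in> V" "y = f v0" using y by auto
    show ?thesis
    proof (rule card_inj_on_le)
      show "inj_on (\<lambda>v. v - v0) {v\<in>V. f v = y}" by (simp add: inj_on_def)
      show "(\<lambda>v. v - v0) ` {v\<in>V. f v = y} \<subseteq> {v\<in>V. f v = 0}"
        using v0 diff hom by auto
    qed (use fin in simp)
  qed
  have "card V = (\<Sum>y\<in>f ` V. card {v\<in>V. f v = y})"
    unfolding card_eq_sum by (rule sum.image_gen[OF fin])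
  also have "\<dots> \<le> (\<Sum>y\<in>f ` V. card {v\<in>V. f v = 0})"
    by (rule sum_mono) (rule fiber)
  finally show ?thesis by simp
qed

text \<open>Tuples are extended by \<open>0\<close> rather than \<open>undefined\<close>, so that
  pointwise addition and subtraction preserve this shape; \<open>ext\<close> transports the count
  from extensional functions.\<close>

lemma
  fixes X :: "nat \<Rightarrow> 'a::zero set"
  assumes "\<And>i. i < d \<Longrightarrow> finite (X i)"
  shows finite_zero_extended: "finite {w. (\<forall>i<d. w i \<in> X i) \<and> (\<forall>i\<ge>d. w i = 0)}"
    and card_zero_extended: "card {w. (\<forall>i<d. w i \<in> X i) \<and> (\<forall>i\<ge>d. w i = 0)} = (\<Prod>i<d. card (X i))"
proof -
  define ext where "ext w = (\<lambda>i. if i < d then w i else 0)" for w :: "nat \<Rightarrow> 'a"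
  have eq: "{w. (\<forall>i<d. w i \<in> X i) \<and> (\<forall>i\<ge>d. w i = 0)} = ext ` (Pi\<^sub>E {..<d} X)"
  proof (intro equalityI subsetI)
    fix w assume w: "w \<in> {w. (\<forall>i<d. w i \<in> X i) \<and> (\<forall>i\<ge>d. w i = 0)}"
    then have "w = ext (restrict w {..<d})" by (auto simp: ext_def fun_eq_iff)
    moreover have "restrict w {..<d} \<in> Pi\<^sub>E {..<d} X" using w by auto
    ultimately show "w \<in> ext ` (Pi\<^sub>E {..<d} X)" by (rule image_eqI)
  next
    fix w assume "w \<in> ext ` (Pi\<^sub>E {..<d} X)"
    then obtain u where u: "u \<in> Pi\<^sub>E {..<d} X" "w = ext u" by blast
    then have "u i \<in> X i" if "i < d" for i using that by (simp add: PiE_mem)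
    then show "w \<in> {w. (\<forall>i<d. w i \<in> X i) \<and> (\<forall>i\<ge>d. w i = 0)}"
      unfolding u(2) ext_def by simp
  qed
  have inj: "inj_on ext (Pi\<^sub>E {..<d} X)"
  proof (rule inj_onI)
    fix v w assume v: "v \<in> Pi\<^sub>E {..<d} X" "w \<in> Pi\<^sub>E {..<d} X" "ext v = ext w"
    have "v i = w i" if "i < d" for i
      using fun_cong[OF v(3), of i] that by (simp add: ext_def)
    then show "v = w" by (intro PiE_ext[OF v(1,2)]) auto
  qed
  show "finite {w. (\<forall>i<d. w i \<in> X i) \<and> (\<forall>i\<ge>d. w i = 0)}"
    unfolding eq using assms by (intro finite_imageI finite_PiE) auto
  show "card {w. (\<forall>i<d. w i \<in> X i) \<and> (\<forall>i\<ge>d. w i = 0)} = (\<Prod>i<d. card (X i))"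
    unfolding eq card_image[OF inj] by (simp add: card_PiE)
qed

lemma poly_eq_sum_lessThan:
  fixes x :: "'a::comm_semiring_1"
  assumes "\<And>k. k \<ge> d \<Longrightarrow> coeff P k = 0"
  shows "poly P x = (\<Sum>k<d. coeff P k * x ^ k)"
proof -
  have "poly P x = (\<Sum>k\<le>degree P + d. coeff P k * x ^ k)"
    unfolding poly_altdef by (rule sum.mono_neutral_left) (auto simp: coeff_eq_0)
  also have "\<dots> = (\<Sum>k<d. coeff P k * x ^ k)"
    by (rule sum.mono_neutral_right) (use assms in auto)
  finally show ?thesis .
qed

section \<open>A field with \<open>q ^ m\<close> elements\<close>

locale finite_field_extension = embedded_field_char +
  fixes l m :: nat
  assumes finite_F: "finite F" and card_F: "card F = (p ^ l) ^ m" and l: "l > 0" and m: "m > 0"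
begin

definition q where "q = p ^ l"
definition n where "n = q ^ m - 1"

lemma q_gt_1: "q > 1"
  unfolding q_def using one_less_power[OF prime_gt_1_nat[OF prime_p] l] .

lemma q_pow_pos: "q ^ i > 0"
  using q_gt_1 by simp

lemma card_F_q: "card F = q ^ m"
  by (simp add: card_F q_def)

lemma Suc_n: "Suc n = q ^ m"
  using q_pow_pos[of m] by (simp add: n_def)

lemma frob_add: "x \<in> F \<Longrightarrow> y \<in> F \<Longrightarrow> (x + y) ^ (q ^ i) = x ^ (q ^ i) + y ^ (q ^ i)"
  using frobenius_add[of x y "l * i"] by (simp add: q_def power_mult)

lemma frob_sum: "(\<And>a. a \<in> I \<Longrightarrow> f a \<in> F) \<Longrightarrow> (\<Sum>a\<in>I. f a) ^ (q ^ i) = (\<Sum>a\<in>I. f a ^ (q ^ i))"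
  using frobenius_sum[of I f "l * i"] by (simp add: q_def power_mult)

lemma frob_diff:
  assumes "x \<in> F" "y \<in> F"
  shows "(x - y) ^ (q ^ i) = x ^ (q ^ i) - y ^ (q ^ i)"
  using frob_add[OF F_diff[OF assms] assms(2), of i] by simp

lemma F_frob: "x \<in> F \<Longrightarrow> x ^ (q ^ i) \<in> F"
  using F_power q_pow_pos by blast

lemma card_nonzero: "card (F - {0}) = n"
  using finite_F F_0 card_F_q by (simp add: n_def)

lemma bij_betw_mult:
  assumes z: "z \<in> F" "z \<noteq> 0"
  shows "bij_betw (\<lambda>y. z * y) (F - {0}) (F - {0})"
proof (rule bij_betwI')
  show "z * x = z * y \<longleftrightarrow> x = y" if "x \<in> F - {0}" "y \<in> F - {0}" for x y
    using cancel[OF z, of x y] that by auto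
  show "z * x \<in> F - {0}" if "x \<in> F - {0}" for x
    using no_zero_divisors[OF z(1), of x] that z by (auto intro: F_mult)
  show "\<exists>x\<in>F - {0}. y = z * x" if y: "y \<in> F - {0}" for y
  proof -
    obtain w where w: "e * w = w" "z * w = e" using inverse_ex[of z] z by (auto simp: F_def)
    then have eq: "y = z * (w * y)" using y by (simp add: F_simps flip: mult.assoc)
    moreover have "w * y \<in> F" using y F_mult_right by auto
    moreover have "w * y \<noteq> 0" using eq y by auto
    ultimately show ?thesis by blast
  qed
qed

text \<open>Multiplication by \<open>z\<close> permutes the nonzero elements, so their product
  \<open>W\<close> satisfies \<open>W = z ^ n * W\<close>.\<close>

lemma unit_power:
  assumes z: "z \<in> F" "z \<noteq> 0"
  shows "z ^ n = e"
proof -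
  define W where "W = e * (\<Prod>y\<in>F - {0}. y)"
  have "W = e * (\<Prod>y\<in>F - {0}. z * y)"
    unfolding W_def prod.reindex_bij_betw[OF bij_betw_mult[OF z], of "\<lambda>y. y"] ..
  also have "\<dots> = z ^ n * W"
    unfolding prod.distrib prod_constant card_nonzero W_def by (rule mult.left_commute)
  finally have eq: "W = z ^ n * W" .
  have W: "W \<in> F" "W \<noteq> 0" unfolding W_def using prod_neq_0[of "F - {0}" "\<lambda>y. y"] F_mult_e by auto
  have "F - {0} \<noteq> {}" using z by auto
  then have "n > 0" using finite_F card_gt_0_iff[of "F - {0}"] unfolding card_nonzero by simp
  then have "z ^ n \<in> F" using F_power z by auto
  moreover have "W * z ^ n = W * e" using eq F_simps(2)[OF W(1)] by (metis mult.commute)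
  ultimately show ?thesis using cancel[OF W] F_e by blast
qed

lemma power_card: "y \<in> F \<Longrightarrow> y ^ (q ^ m) = y"
  using unit_power[of y] by (cases "y = 0") (simp_all add: F_simps flip: Suc_n)

text \<open>The fixed points are roots of a polynomial of degree at most \<open>q ^ i\<close>. The
  case \<open>i = 1\<close> bounds the subfield \<open>G\<close>, the case \<open>i = h\<close> the
  intermediate field that governs the size of \<open>A\<close>.\<close>

lemma card_fixed_le: "finite {y\<in>F. y ^ (q ^ i) = y} \<and> (i > 0 \<longrightarrow> card {y\<in>F. y ^ (q ^ i) = y} \<le> q ^ i)"
proof (intro conjI impI)
  assume i: "i > 0"
  define f where "f = monom e (q ^ i) - monom e 1"
  have gt: "q ^ i > 1" using one_less_power[OF q_gt_1 i] .
  then have "coeff f (q ^ i) = e" by (simp add: f_def)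
  then have "f \<noteq> 0" using e_neq_0 by auto
  moreover have "smult e f = f" by (simp add: f_def smult_diff_right smult_monom idem)
  ultimately have "card {x\<in>F. poly f x = 0} \<le> degree f"
    using card_roots_le by blast
  also have "degree f \<le> q ^ i"
    unfolding f_def using gt by (intro degree_diff_le) (auto intro: order.trans[OF degree_monom_le])
  also have "{x\<in>F. poly f x = 0} = {y\<in>F. y ^ (q ^ i) = y}"
    by (auto simp: f_def poly_monom F_simps F_frob)
  finally show "card {y\<in>F. y ^ (q ^ i) = y} \<le> q ^ i" .
qed (use finite_F in simp)

definition G where "G = {y\<in>F. y ^ q = y}"

definition Tr :: "'a \<Rightarrow> 'a" where "Tr y = (\<Sum>i<m. y ^ (q ^ i))"

lemma G_diff: "x \<in> G \<Longrightarrow> y \<in> G \<Longrightarrow> x - y \<in> G"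
  using frob_diff[of x y 1] by (auto simp: G_def F_diff)

lemma G_0: "0 \<in> G"
  using q_gt_1 by (simp add: G_def F_0 power_0_left)

lemma Tr_diff: "x \<in> F \<Longrightarrow> y \<in> F \<Longrightarrow> Tr (x - y) = Tr x - Tr y"
  by (simp add: Tr_def frob_diff sum_subtractf)

lemma Tr_add: "x \<in> F \<Longrightarrow> y \<in> F \<Longrightarrow> Tr (x + y) = Tr x + Tr y"
  by (simp add: Tr_def frob_add sum.distrib)

lemma Tr_0: "Tr 0 = 0"
  using Tr_diff[OF F_0 F_0] by simp

text \<open>Raising to the power \<open>q\<close> permutes the summands cyclically, because
  \<open>y ^ (q ^ m) = y\<close>.\<close>

lemma Tr_G:
  assumes y: "y \<in> F"
  shows "Tr y \<in> G"
proof -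
  have "Tr y ^ q = (\<Sum>i<m. (y ^ (q ^ i)) ^ (q ^ 1))"
    unfolding Tr_def using frob_sum[of "{..<m}" "\<lambda>i. y ^ (q ^ i)" 1] F_frob[OF y] by simp
  also have "\<dots> = (\<Sum>i<m. y ^ (q ^ Suc i))"
    by (simp add: mult.commute flip: power_mult)
  also have "\<dots> = (\<Sum>i<Suc m. y ^ (q ^ i)) - y" unfolding sum.lessThan_Suc_shift by simp
  also have "\<dots> = Tr y" using power_card[OF y] by (simp add: Tr_def)
  finally show ?thesis using F_frob[OF y] by (auto simp: G_def Tr_def intro: F_sum)
qed

lemma finite_G: "finite G"
  using finite_F by (simp add: G_def)

text \<open>The kernel of the trace consists of roots of a polynomial of degree at most
  \<open>q ^ (m - 1)\<close>. Since \<open>G\<close> has at most \<open>q\<close> elements,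
  surjectivity onto \<open>G\<close> will follow.\<close>

lemma card_Tr_image: "card (Tr ` F) \<ge> q"
proof -
  define f where "f = (\<Sum>i<m. monom e (q ^ i))"
  have inj: "q ^ i = q ^ j \<longleftrightarrow> i = j" for i j using q_gt_1 by (simp add: power_inject_exp)
  have "coeff f (q ^ (m - 1)) = e"
    using m by (simp add: f_def coeff_sum inj)
  then have "f \<noteq> 0" using e_neq_0 by auto
  moreover have "smult e f = f" 
    unfolding smult_e_iff f_def coeff_sum by (auto intro!: F_sum simp: F_e F_0)
  ultimately have "card {x\<in>F. poly f x = 0} \<le> degree f"
    using card_roots_le by blast
  also have "degree f \<le> q ^ (m - 1)"
    unfolding f_def using q_gt_1
    by (intro degree_sum_le) (auto intro!: order.trans[OF degree_monom_le] power_increasing)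
  also have "{x\<in>F. poly f x = 0} = {x\<in>F. Tr x = 0}"
    by (auto simp: f_def poly_monom poly_sum Tr_def F_simps F_frob)
  finally have "card {x\<in>F. Tr x = 0} \<le> q ^ (m - 1)" .
  moreover have "card F \<le> card (Tr ` F) * card {x\<in>F. Tr x = 0}"
    by (rule card_le_image_times_kernel) (auto simp: finite_F F_diff Tr_diff)
  ultimately have "q ^ m \<le> card (Tr ` F) * q ^ (m - 1)"
    unfolding card_F_q by (meson le_trans mult_le_mono2)
  moreover have "q ^ m = q * q ^ (m - 1)" using power_minus_mult[OF m, of q] by (simp add: mult.commute)
  ultimately have "q * q ^ (m - 1) \<le> card (Tr ` F) * q ^ (m - 1)" by simp
  then show ?thesis using q_gt_1 by simp
qed

lemma Tr_image: "Tr ` F = G" and card_G: "card G = q"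
proof -
  have sub: "Tr ` F \<subseteq> G" using Tr_G by auto
  have le: "card G \<le> q" using card_fixed_le[of 1] by (simp add: G_def)
  show "Tr ` F = G"
    by (rule card_seteq[OF finite_G sub]) (use le card_Tr_image in simp)
  then show "card G = q" using le card_Tr_image by simp
qed

end

subsection \<open>The pair of cyclic codes\<close>

text \<open>\<open>D + 2\<close> is the distance \<open>c\<close>, and \<omega> indexes the
  coordinates by the nonzero field elements.\<close>

locale bch_css = finite_field_extension +
  fixes h D :: nat and \<omega> :: "nat \<Rightarrow> 'a"
  assumes q_ge_3: "3 \<le> p ^ l" and m_eq: "m = 2 * h" and h_pos: "h > 0" and D_le: "D + 2 \<le> p ^ l"
    and \<omega>: "bij_betw \<omega> {..<(p ^ l) ^ m - 1} (F - {0})"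
begin

lemma q3: "q \<ge> 3" and Dq: "D + 2 \<le> q"
  using q_ge_3 D_le by (simp_all add: q_def)

lemma \<omega>_bij: "bij_betw \<omega> {..<n} (F - {0})"
  using \<omega> by (simp add: n_def q_def)

lemma \<omega>_F: "j < n \<Longrightarrow> \<omega> j \<in> F" and \<omega>_neq_0: "j < n \<Longrightarrow> \<omega> j \<noteq> 0"
  using \<omega>_bij by (auto simp: bij_betw_def)

lemma \<omega>_inj: "inj_on \<omega> {..<n}"
  using \<omega>_bij by (simp add: bij_betw_def)

text \<open>As \<open>m = 2 * h\<close>, the power \<open>x ^ s\<close> is the norm of
  \<open>x\<close> to the subfield with \<open>q ^ h\<close> elements.\<close>

definition s where "s = q ^ h + 1"

lemma exponent_less: "k \<le> D \<Longrightarrow> s + k < n"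
proof -
  assume k: "k \<le> D"
  have qh: "q ^ h \<ge> q" using h_pos q_gt_1 by (simp add: self_le_power)
  have "q ^ m = q ^ h * q ^ h" by (simp add: m_eq mult_2 power_add)
  also have "\<dots> \<ge> 3 * q ^ h" using qh q3 by (intro mult_le_mono1) simp
  finally have "3 * q ^ h \<le> q ^ m" .
  then show ?thesis unfolding s_def n_def using k qh q3 Dq by linarith
qed

lemma n_ge_2: "n \<ge> 2"
  using exponent_less[of 0] by (simp add: s_def)

text \<open>The inverse of \<open>\<omega> j\<close> in \<open>F\<close>, since nonzero elements
  satisfy \<open>z ^ n = e\<close>.\<close>

definition \<theta> where "\<theta> j = \<omega> j ^ (n - 1)"

lemma \<omega>_\<theta>: "j < n \<Longrightarrow> \<omega> j * \<theta> j = e"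
  using unit_power[OF \<omega>_F \<omega>_neq_0, of j] n_ge_2 unfolding \<theta>_def
  by (metis Suc_diff_1 less_le_trans pos2 power_Suc)

lemma \<theta>_F: "j < n \<Longrightarrow> \<theta> j \<in> F"
  unfolding \<theta>_def using F_power[OF \<omega>_F] n_ge_2 by simp

lemma \<theta>_inj: "inj_on \<theta> {..<n}"
proof (rule inj_onI)
  fix i j assume ij: "i \<in> {..<n}" "j \<in> {..<n}" "\<theta> i = \<theta> j"
  then have "\<omega> j = \<omega> i * (\<theta> j * \<omega> j)"
    using \<omega>_\<theta>[of i] \<omega>_F[of j] by (simp add: F_simps flip: mult.assoc)
  also have "\<dots> = \<omega> i"
    using ij \<omega>_\<theta>[of j] \<omega>_F[of i] by (simp add: mult.commute[of "\<theta> j"] F_simps)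
  finally show "i = j" using inj_onD[OF \<omega>_inj] ij by blast
qed

text \<open>The difference of the two monomials has degree below \<open>n\<close>, so it cannot
  vanish at all \<open>n\<close> nonzero elements. The factors \<open>e\<close> keep exponent
  \<open>0\<close> inside \<open>F\<close>.\<close>

lemma power_distinguishes:
  assumes a: "a < n" and b: "b < n" and ab: "a \<noteq> b"
  shows "\<exists>z\<in>F - {0}. e * z ^ a \<noteq> e * z ^ b"
proof (rule ccontr)
  assume contr: "\<not> ?thesis"
  define f where "f = monom e a - monom e b"
  have "coeff f a = e" using ab by (simp add: f_def)
  then have "f \<noteq> 0" using e_neq_0 by auto
  moreover have "smult e f = f"
    unfolding smult_e_iff f_def by (auto simp: F_e F_0 F_diff)
  ultimately have roots: "finite {x\<in>F. poly f x = 0}" "card {x\<in>F. poly f x = 0} \<le> degree f"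
    using card_roots_le by auto
  have "F - {0} \<subseteq> {x\<in>F. poly f x = 0}"
    using contr by (auto simp: f_def poly_monom)
  then have "n \<le> card {x\<in>F. poly f x = 0}"
    using card_mono[OF roots(1)] card_nonzero by metis
  also note roots(2)
  also have "degree f \<le> max a b"
    unfolding f_def by (intro degree_diff_le) (auto intro: order.trans[OF degree_monom_le])
  finally show False using a b by simp
qed

text \<open>In effect, \<open>(s + k) * q ^ f\<close> is not congruent to \<open>i\<close> modulo
  \<open>n\<close>. For \<open>f > 0\<close>, raising to the power \<open>q ^ (m - f)\<close> moves
  the Frobenius shift to the other side; then \<open>s + k\<close> and
  \<open>i * q ^ (m - f)\<close> are both below \<open>n\<close> and can be compared as
  numbers.\<close>

lemma exponents_distinct:
  assumes i: "i \<le> D" and k: "k \<le> D" and f: "f < m"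
  shows "\<exists>z\<in>F - {0}. z ^ ((s + k) * q ^ f) \<noteq> e * z ^ i"
proof -
  obtain b g where b: "b = i * q ^ g" "b < n" "b \<noteq> s + k" "g + f = m \<or> g = 0 \<and> f = 0"
  proof (cases "f = 0")
    case True
    have "i \<noteq> s + k"
      using i Dq self_le_power[of q h] q_gt_1 h_pos by (simp add: s_def)
    moreover have "i < n" using exponent_less[of D] i by simp
    ultimately show ?thesis using True by (intro that[of i 0]) auto
  next
    case False
    define g where "g = m - f"
    have g: "g > 0" "g + f = m" "g < m" using f False by (auto simp: g_def)
    have "i * q ^ g \<le> (q - 2) * q ^ (m - 1)"
      using i Dq g q_gt_1 by (intro mult_le_mono power_increasing) auto
    also have "\<dots> < n"
    proof -
      have "q = (q - 2) + 2" using q3 by simp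
      then have "q * q ^ (m - 1) = (q - 2) * q ^ (m - 1) + 2 * q ^ (m - 1)" by (metis add_mult_distrib)
      moreover have "q ^ m = q * q ^ (m - 1)" using power_minus_mult[OF m, of q] by (simp add: mult.commute)
      ultimately show ?thesis using q_pow_pos[of "m - 1"] unfolding n_def by linarith
    qed
    finally have "i * q ^ g < n" .
    \<comment> \<open>Modulo \<open>q\<close> the left side is \<open>0\<close> and the right side
      is \<open>k + 1\<close>, which lies strictly between \<open>0\<close> and
      \<open>q\<close>.\<close>
    moreover have "i * q ^ g \<noteq> s + k"
    proof
      assume eq: "i * q ^ g = s + k"
      have "q dvd i * q ^ g" "q dvd q ^ h" using g h_pos by (simp_all add: dvd_power)
      then have "q dvd Suc k" unfolding eq s_def
        by (metis add.assoc dvd_add_right_iff plus_1_eq_Suc)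
      then show False using k Dq by (auto dest: dvd_imp_le)
    qed
    ultimately show ?thesis using g(2) by (intro that[of "i * q ^ g" g]) auto
  qed
  obtain z where z: "z \<in> F - {0}" "e * z ^ (s + k) \<noteq> e * z ^ b"
    using power_distinguishes[of "s + k" b] exponent_less[OF k] b by metis
  have "z ^ ((s + k) * q ^ f) \<noteq> e * z ^ i"
  proof
    assume eq: "z ^ ((s + k) * q ^ f) = e * z ^ i"
    have zs: "z ^ (s + k) \<in> F" using z by (intro F_power) (auto simp: s_def)
    have e_pow: "e ^ (q ^ g) = e"
      using e_power_mult[OF F_e, of "q ^ g"] F_simps(2)[OF F_frob[OF F_e]] by simp
    have "(z ^ (s + k)) ^ (q ^ (f + g)) = (z ^ ((s + k) * q ^ f)) ^ (q ^ g)"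
      by (simp only: power_add[of q] power_mult)
    also have "\<dots> = e * z ^ b"
      unfolding eq b(1) by (simp only: power_mult_distrib e_pow power_mult)
    also have "(z ^ (s + k)) ^ (q ^ (f + g)) = z ^ (s + k)"
      using b(4) power_card[OF zs] by (auto simp: add.commute)
    finally have "e * z ^ (s + k) = e * z ^ b" using F_simps(1)[OF zs] by simp
    then show False using z by simp
  qed
  then show ?thesis using z by blast
qed

text \<open>Substituting \<open>z * y\<close> for \<open>y\<close> multiplies the sum by \<open>z ^ ((s + k) * q ^ f) * z ^ (-i)\<close>.\<close>

lemma orthogonality:
  assumes i: "i \<le> D" and k: "k \<le> D" and f: "f < m"
  shows "(\<Sum>j<n. \<omega> j ^ ((s + k) * q ^ f) * \<theta> j ^ i) = 0"
proof -
  define a where "a = (s + k) * q ^ f"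
  have a_pos: "a > 0" using q_pow_pos by (simp add: a_def s_def)
  define T where "T = (\<Sum>y\<in>F - {0}. y ^ a * (y ^ (n - 1)) ^ i)"
  have T_F: "T \<in> F" unfolding T_def using F_power[OF _ a_pos] by (intro F_sum F_mult) auto
  \<comment> \<open>\<open>z\<close> is chosen so that the factor \<open>u\<close> differs from
    \<open>e\<close>; then \<open>T = u * T\<close> forces \<open>T = 0\<close>.\<close>
  obtain z where z: "z \<in> F" "z \<noteq> 0" "z ^ a \<noteq> e * z ^ i"
    using exponents_distinct[OF assms] by (auto simp: a_def)
  define u where "u = z ^ a * (z ^ (n - 1)) ^ i"
  have u_F: "u \<in> F" unfolding u_def using F_power[OF z(1) a_pos] by (rule F_mult)
  have "T = (\<Sum>y\<in>F - {0}. (z * y) ^ a * ((z * y) ^ (n - 1)) ^ i)"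
    unfolding T_def
    using sum.reindex_bij_betw[OF bij_betw_mult[OF z(1,2)], of "\<lambda>y. y ^ a * (y ^ (n - 1)) ^ i"] by simp
  also have "\<dots> = u * T"
    by (simp add: T_def u_def sum_distrib_left power_mult_distrib mult_ac)
  finally have "T = u * T" .
  then have uT: "(u - e) * T = 0" by (simp add: left_diff_distrib F_simps(1)[OF T_F])
  have "u \<noteq> e"
  proof
    assume "u = e"
    have "z ^ (n - 1) * z = z ^ n" by (rule power_minus_mult) (use n_ge_2 in simp)
    then have "(z ^ (n - 1)) ^ i * z ^ i = (z ^ n) ^ i" by (simp only: flip: power_mult_distrib)
    then have "u * z ^ i = z ^ a * e ^ i"
      by (simp add: u_def mult.assoc unit_power[OF z(1,2)])
    also have "\<dots> = z ^ a"
      using e_power_mult[OF F_power[OF z(1) a_pos]] by (simp add: mult.commute)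
    finally show False using z(3) \<open>u = e\<close> by simp
  qed
  then have "T = 0"
    using no_zero_divisors[OF F_diff[OF u_F F_e] T_F uT] by auto
  moreover have "(\<Sum>j<n. \<omega> j ^ a * \<theta> j ^ i) = T"
    unfolding T_def \<theta>_def
    by (rule sum.reindex_bij_betw[OF \<omega>_bij, of "\<lambda>y. y ^ a * (y ^ (n - 1)) ^ i"])
  ultimately show ?thesis by (simp add: a_def)
qed

section \<open>The codes \<open>A\<close> and \<open>B\<close>: inclusion, distance and
  projections\<close>

definition V :: "(nat \<Rightarrow> 'a) set" where
  "V = {v. (\<forall>j<n. v j \<in> G) \<and> (\<forall>j\<ge>n. v j = 0)}"

definition B :: "(nat \<Rightarrow> 'a) set" where
  "B = {v\<in>V. \<forall>i\<le>D. (\<Sum>j<n. v j * \<theta> j ^ i) = 0}"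

definition encode :: "(nat \<Rightarrow> 'a) \<Rightarrow> nat \<Rightarrow> 'a" where
  "encode \<beta> = (\<lambda>j. if j < n then Tr (\<Sum>k\<le>D. \<beta> k * \<omega> j ^ (s + k)) else 0)"

definition A :: "(nat \<Rightarrow> 'a) set" where
  "A = encode ` {\<beta>. \<forall>k. \<beta> k \<in> F}"

lemma \<omega>_power_F: "j < n \<Longrightarrow> \<omega> j ^ (s + k) \<in> F"
  by (rule F_power) (simp_all add: \<omega>_F s_def)

lemma encode_arg_F: "j < n \<Longrightarrow> (\<Sum>k\<le>D. \<beta> k * \<omega> j ^ (s + k)) \<in> F"
  using \<omega>_power_F by (intro F_sum F_mult_right)

lemma V_diff: "v \<in> V \<Longrightarrow> w \<in> V \<Longrightarrow> v - w \<in> V"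
  by (auto simp: V_def G_diff)

lemma B_diff: "v \<in> B \<Longrightarrow> w \<in> B \<Longrightarrow> v - w \<in> B"
  using V_diff by (auto simp: B_def left_diff_distrib sum_subtractf)

lemma encode_diff: "encode \<beta> - encode \<gamma> = encode (\<lambda>k. \<beta> k - \<gamma> k)"
  by (auto simp: encode_def fun_eq_iff left_diff_distrib sum_subtractf Tr_diff encode_arg_F)

lemma A_diff: "v \<in> A \<Longrightarrow> w \<in> A \<Longrightarrow> v - w \<in> A"
  unfolding A_def using encode_diff F_diff by (auto intro!: image_eqI)

lemma A_0: "0 \<in> A"
  unfolding A_def by (rule image_eqI[of _ _ "\<lambda>_. 0"]) (auto simp: encode_def Tr_0 F_0 fun_eq_iff)

text \<open>Additivity of Frobenius expands the trace, and each check becomes a combination of the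
  power sums that vanish by \<open>orthogonality\<close>.\<close>

lemma A_subset_B: "A \<subseteq> B"
proof
  fix v assume "v \<in> A"
  then obtain \<beta> where \<beta>: "\<And>k. \<beta> k \<in> F" "v = encode \<beta>" by (auto simp: A_def)
  have "v \<in> V" unfolding V_def \<beta>(2) encode_def using Tr_G encode_arg_F by auto
  moreover have "(\<Sum>j<n. v j * \<theta> j ^ i) = 0" if i: "i \<le> D" for i
  proof -
    have "(\<Sum>j<n. v j * \<theta> j ^ i) =
      (\<Sum>j<n. \<Sum>f<m. \<Sum>k\<le>D. \<beta> k ^ (q ^ f) * (\<omega> j ^ ((s + k) * q ^ f) * \<theta> j ^ i))"
    proof (rule sum.cong)
      fix j assume "j \<in> {..<n}"
      then have j: "j < n" by simp
      have "v j = (\<Sum>f<m. (\<Sum>k\<le>D. \<beta> k * \<omega> j ^ (s + k)) ^ (q ^ f))"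
        using j by (simp add: \<beta>(2) encode_def Tr_def)
      also have "\<dots> = (\<Sum>f<m. \<Sum>k\<le>D. \<beta> k ^ (q ^ f) * \<omega> j ^ ((s + k) * q ^ f))"
      proof (rule sum.cong)
        fix f
        show "(\<Sum>k\<le>D. \<beta> k * \<omega> j ^ (s + k)) ^ (q ^ f) =
          (\<Sum>k\<le>D. \<beta> k ^ (q ^ f) * \<omega> j ^ ((s + k) * q ^ f))"
          by (subst frob_sum) (simp_all add: F_mult \<beta>(1) power_mult_distrib power_mult)
      qed simp
      finally show "v j * \<theta> j ^ i =
        (\<Sum>f<m. \<Sum>k\<le>D. \<beta> k ^ (q ^ f) * (\<omega> j ^ ((s + k) * q ^ f) * \<theta> j ^ i))"
        by (simp add: sum_distrib_right mult.assoc)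
    qed simp
    also have "\<dots> = (\<Sum>f<m. \<Sum>k\<le>D. \<Sum>j<n. \<beta> k ^ (q ^ f) * (\<omega> j ^ ((s + k) * q ^ f) * \<theta> j ^ i))"
      by (subst sum.swap, rule sum.cong[OF refl], rule sum.swap)
    also have "\<dots> = 0"
      using orthogonality[OF i] by (simp flip: sum_distrib_left)
    finally show ?thesis .
  qed
  ultimately show "v \<in> B" by (simp add: B_def)
qed

text \<open>By the checks, \<open>v\<close> is orthogonal to all polynomials in \<theta> of degree
  at most \<open>D\<close>. On at most \<open>D + 1\<close> points such a polynomial can single out
  one position of the support.\<close>

lemma B_distance:
  assumes S: "S \<subseteq> {..<n}" "card S \<le> D + 1" and v: "v \<in> B" "\<And>j. j \<notin> S \<Longrightarrow> v j = 0"
  shows "v = 0"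
proof (rule ccontr)
  assume "v \<noteq> 0"
  then obtain j0 where j0: "v j0 \<noteq> 0" by (auto simp: fun_eq_iff)
  then have j0S: "j0 \<in> S" "j0 < n" using v(2) S(1) by auto
  have finS: "finite S" using S(1) finite_subset by blast
  have inj: "inj_on \<theta> S" using \<theta>_inj S(1) inj_on_subset by blast
  have "\<exists>P. smult e P = P \<and> (\<forall>k\<ge>card (\<theta> ` S). coeff P k = 0) \<and>
    (\<forall>t\<in>\<theta> ` S. poly P t = (if t = \<theta> j0 then e else 0))"
    by (rule interpolation) (use finS S(1) \<theta>_F F_e F_0 in auto)
  then obtain P where P: "\<And>k. k \<ge> card (\<theta> ` S) \<Longrightarrow> coeff P k = 0"
    "\<And>t. t \<in> \<theta> ` S \<Longrightarrow> poly P t = (if t = \<theta> j0 then e else 0)" by blast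
  have deg: "coeff P k = 0" if "k \<ge> Suc D" for k
    using P(1) that S(2) card_image[OF inj] by simp
  have "(\<Sum>j<n. v j * poly P (\<theta> j)) = (\<Sum>j<n. if j = j0 then v j0 else 0)"
  proof (rule sum.cong)
    fix j assume j: "j \<in> {..<n}"
    show "v j * poly P (\<theta> j) = (if j = j0 then v j0 else 0)"
    proof (cases "j \<in> S")
      case True
      have "v j \<in> F" using v(1) j by (auto simp: B_def V_def G_def)
      then show ?thesis
        using P(2)[of "\<theta> j"] True j0S inj_on_eq_iff[OF inj True j0S(1)] by (auto simp: F_simps)
    next
      case False
      then show ?thesis using v(2) j0S by auto
    qed
  qed simp
  also have "\<dots> = v j0" using j0S by simp
  also have "(\<Sum>j<n. v j * poly P (\<theta> j)) = (\<Sum>j<n. \<Sum>i<Suc D. coeff P i * (v j * \<theta> j ^ i))"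
    using poly_eq_sum_lessThan[of "Suc D" P] deg by (simp add: sum_distrib_left mult_ac distrib_left)
  also have "\<dots> = (\<Sum>i<Suc D. coeff P i * (\<Sum>j<n. v j * \<theta> j ^ i))"
    unfolding sum_distrib_left by (rule sum.swap)
  also have "\<dots> = 0" using v(1) by (simp add: B_def less_Suc_eq_le)
  finally show False using j0 by simp
qed

text \<open>Each target value is the trace of some \<open>y j\<close>, and the \<open>D + 1\<close>
  free coefficients interpolate at up to \<open>D + 1\<close> points.\<close>

lemma A_projection:
  assumes S: "S \<subseteq> {..<n}" "card S \<le> D + 1" and u: "\<And>j. j \<in> S \<Longrightarrow> u j \<in> G"
  shows "\<exists>a\<in>A. \<forall>j\<in>S. a j = u j"
proof -
  have finS: "finite S" using S(1) finite_subset by blast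
  have inj: "inj_on \<omega> S" using \<omega>_inj S(1) inj_on_subset by blast
  have "\<forall>j\<in>S. \<exists>y\<in>F. Tr y = u j" using u unfolding Tr_image[symmetric] by force
  then obtain y where y: "\<And>j. j \<in> S \<Longrightarrow> y j \<in> F" "\<And>j. j \<in> S \<Longrightarrow> Tr (y j) = u j" by metis
  \<comment> \<open>The factor \<open>\<theta> j ^ s\<close> divides out the shift by
    \<open>s\<close> in the exponents of \<open>encode\<close>.\<close>
  define val where "val t = y (inv_into S \<omega> t) * \<theta> (inv_into S \<omega> t) ^ s" for t
  have val: "val (\<omega> j) = y j * \<theta> j ^ s" if "j \<in> S" for j
    using inv_into_f_f[OF inj that] by (simp add: val_def)
  have "\<exists>P. smult e P = P \<and> (\<forall>k\<ge>card (\<omega> ` S). coeff P k = 0) \<and> (\<forall>t\<in>\<omega> ` S. poly P t = val t)"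
    by (rule interpolation) (use finS S(1) \<omega>_F val y(1) F_mult in auto)
  then obtain P where P: "smult e P = P" "\<And>k. k \<ge> card (\<omega> ` S) \<Longrightarrow> coeff P k = 0"
    "\<And>t. t \<in> \<omega> ` S \<Longrightarrow> poly P t = val t" by blast
  have deg: "coeff P k = 0" if "k \<ge> Suc D" for k
    using P(2) that S(2) card_image[OF inj] by simp
  have "encode (coeff P) j = u j" if j: "j \<in> S" for j
  proof -
    have jn: "j < n" using j S(1) by auto
    have "poly P (\<omega> j) = (\<Sum>k\<le>D. coeff P k * \<omega> j ^ k)"
      using poly_eq_sum_lessThan[of "Suc D" P] deg by (simp add: lessThan_Suc_atMost)
    then have "(\<Sum>k\<le>D. coeff P k * \<omega> j ^ (s + k)) = \<omega> j ^ s * poly P (\<omega> j)"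
      by (simp add: sum_distrib_left power_add mult_ac)
    also have "\<dots> = (\<omega> j * \<theta> j) ^ s * y j"
      using P(3) val j by (simp add: power_mult_distrib mult_ac)
    also have "\<dots> = e ^ Suc (q ^ h) * y j" using \<omega>_\<theta>[OF jn] by (simp add: s_def)
    also have "\<dots> = y j"
      by (rule e_power_mult[OF y(1)[OF j]])
    finally show ?thesis using y(2)[OF j] jn by (simp add: encode_def)
  qed
  moreover have "encode (coeff P) \<in> A"
    unfolding A_def using P(1) by (auto simp: smult_e_iff)
  ultimately show ?thesis by blast
qed

section \<open>Sizes of the codes\<close>

lemma finite_V: "finite V" and card_V: "card V = q ^ n"
  unfolding V_def using finite_zero_extended[of n "\<lambda>_. G"] card_zero_extended[of n "\<lambda>_. G"]
  by (simp_all add: finite_G card_G)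

text \<open>\<open>B\<close> is the kernel of \<open>D + 1\<close> checks on \<open>V\<close>. The
  check for \<open>i = 0\<close> is the sum of the entries, so it lies in \<open>G\<close> and takes
  at most \<open>q\<close> values; the others take at most \<open>q ^ m\<close> each.\<close>

lemma card_B_ge: "q ^ n \<le> q * q ^ (m * D) * card B"
proof -
  define \<Phi> where "\<Phi> v = (\<lambda>i. if i < Suc D then \<Sum>j<n. v j * \<theta> j ^ i else 0)" for v
  define X where "X i = (if i = 0 then G else F)" for i :: nat
  have fin: "finite (X i)" for i by (simp add: X_def finite_G finite_F)
  have ker: "{v\<in>V. \<Phi> v = 0} = B"
    by (auto simp: B_def \<Phi>_def fun_eq_iff less_Suc_eq_le)
  have G_sum: "(\<Sum>j<n. v j) \<in> G" if "v \<in> V" for v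
  proof -
    have "(\<Sum>j\<in>J. v j) \<in> G" if "J \<subseteq> {..<n}" "finite J" for J
      using that(2,1)
    proof (induction J rule: finite_induct)
      case (insert j J)
      then have "v j - (0 - (\<Sum>j\<in>J. v j)) \<in> G"
        using \<open>v \<in> V\<close> by (intro G_diff G_0) (auto simp: V_def)
      then show ?case using insert.hyps by simp
    qed (simp add: G_0)
    then show ?thesis by blast
  qed
  have im: "\<Phi> ` V \<subseteq> {w. (\<forall>i<Suc D. w i \<in> X i) \<and> (\<forall>i\<ge>Suc D. w i = 0)}"
  proof (intro image_subsetI CollectI conjI allI impI)
    fix v i assume v: "v \<in> V" and i: "i < Suc D"
    have "(\<Sum>j<n. v j * \<theta> j ^ i) \<in> F"
      using v by (intro F_sum F_mult) (auto simp: V_def G_def)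
    then show "\<Phi> v i \<in> X i" using i G_sum[OF v] by (simp add: \<Phi>_def X_def)
  qed (simp add: \<Phi>_def)
  have "card (\<Phi> ` V) \<le> (\<Prod>i<Suc D. card (X i))"
    using card_mono[OF finite_zero_extended im] fin card_zero_extended[of "Suc D" X] by simp
  also have "\<dots> = q * q ^ (m * D)"
    unfolding prod.lessThan_Suc_shift by (simp add: X_def card_G card_F_q power_mult)
  finally have im_le: "card (\<Phi> ` V) \<le> q * q ^ (m * D)" .
  have "card V \<le> card (\<Phi> ` V) * card {v\<in>V. \<Phi> v = 0}"
    by (rule card_le_image_times_kernel)
      (auto simp: finite_V V_diff \<Phi>_def fun_eq_iff left_diff_distrib sum_subtractf)
  also have "\<dots> \<le> q * q ^ (m * D) * card B" unfolding ker using im_le by (rule mult_le_mono1)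
  finally show ?thesis unfolding card_V .
qed

text \<open>
  As \<open>\<omega> j ^ s\<close> lies in the subfield with \<open>q ^ h\<close> elements, the trace of \<open>\<beta> 0 * \<omega> j ^ s\<close> depends on
  \<open>\<beta> 0\<close> only through its trace to that subfield.
\<close>

lemma card_A_le: "card A \<le> q ^ (h + m * D)"
proof -
  define H where "H = {y\<in>F. y ^ (q ^ h) = y}"
  define X where "X i = (if i = 0 then H else F)" for i :: nat
  have fin: "finite (X i)" for i by (simp add: X_def H_def finite_F)
  \<comment> \<open>For \<open>\<gamma> 0\<close> in \<open>H\<close> the first sum is a trace from
    \<open>H\<close> to \<open>G\<close>.\<close>
  define enc where "enc \<gamma> = (\<lambda>j. if j < n then (\<Sum>f<h. (\<gamma> 0 * \<omega> j ^ s) ^ (q ^ f)) +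
    Tr (\<Sum>k<D. \<gamma> (Suc k) * \<omega> j ^ (s + Suc k)) else 0)" for \<gamma> :: "nat \<Rightarrow> 'a"
  define C where "C = {w. (\<forall>i<Suc D. w i \<in> X i) \<and> (\<forall>i\<ge>Suc D. w i = (0::'a))}"
  have split: "(\<Sum>f<a + b. t f) = (\<Sum>f<a. t f) + (\<Sum>f<b. t (f + a))" for t :: "nat \<Rightarrow> 'a" and a b
    by (induction b) (simp_all add: ac_simps)
  have "A \<subseteq> enc ` C"
  proof
    fix v assume "v \<in> A"
    then obtain \<beta> where \<beta>: "\<And>k. \<beta> k \<in> F" "v = encode \<beta>" by (auto simp: A_def)
    \<comment> \<open>\<open>\<gamma> 0\<close> is the trace of \<open>\<beta> 0\<close> to
      \<open>H\<close>; entries beyond \<open>D\<close>, which do not enter \<open>encode\<close>,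
      are set to \<open>0\<close> to land in the finite set \<open>C\<close>.\<close>
    define \<gamma> where "\<gamma> k = (if k = 0 then \<beta> 0 + \<beta> 0 ^ (q ^ h) else if k < Suc D then \<beta> k else 0)" for k
    have "(\<beta> 0 ^ (q ^ h)) ^ (q ^ h) = \<beta> 0"
      using power_card[OF \<beta>(1)[of 0]] by (simp add: m_eq mult_2 power_add power_mult)
    then have "\<gamma> 0 \<in> H"
      by (simp add: \<gamma>_def H_def F_add \<beta>(1) F_frob frob_add add.commute)
    then have "\<gamma> \<in> C" by (auto simp: C_def X_def \<gamma>_def \<beta>(1))
    moreover have "v = enc \<gamma>"
    proof
      fix j
      show "v j = enc \<gamma> j"
      proof (cases "j < n")
        case j: True
        define w where "w = \<omega> j ^ s"
        have wF: "w \<in> F" using \<omega>_power_F[OF j, of 0] by (simp add: w_def)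
        have "w ^ (q ^ h) = \<omega> j ^ (q ^ m) * \<omega> j ^ (q ^ h)"
          by (simp add: w_def s_def m_eq mult_2 power_mult_distrib)
            (simp add: power_add mult.commute flip: power_mult)
        also have "\<dots> = w" using power_card[OF \<omega>_F[OF j]] by (simp add: w_def s_def)
        finally have w_fix: "w ^ (q ^ h) = w" .
        \<comment> \<open>The summands for \<open>f\<close> and \<open>f + h\<close> are paired;
          since \<open>w\<close> is fixed by the \<open>q ^ h\<close>-th power, each pair collapses
          to a power of \<open>\<gamma> 0 * w\<close>.\<close>
        have "Tr (\<beta> 0 * w) = (\<Sum>f<h + h. (\<beta> 0 * w) ^ (q ^ f))" 
          unfolding Tr_def by (rule sum.cong) (auto simp: m_eq)
        also have "\<dots> = (\<Sum>f<h. (\<beta> 0 * w) ^ (q ^ f)) + (\<Sum>f<h. (\<beta> 0 * w) ^ (q ^ (f + h)))"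
          by (rule split)
        also have "\<dots> = (\<Sum>f<h. (\<gamma> 0 * w) ^ (q ^ f))"
          unfolding sum.distrib[symmetric]
        proof (rule sum.cong)
          fix f
          have "(\<beta> 0 * w) ^ (q ^ (f + h)) = ((\<beta> 0 * w) ^ (q ^ h)) ^ (q ^ f)"
            by (simp add: power_add mult.commute flip: power_mult)
          also have "(\<beta> 0 * w) ^ (q ^ h) = \<beta> 0 ^ (q ^ h) * w"
            by (simp add: power_mult_distrib w_fix)
          finally have "(\<beta> 0 * w) ^ (q ^ f) + (\<beta> 0 * w) ^ (q ^ (f + h)) =
            (\<beta> 0 * w) ^ (q ^ f) + (\<beta> 0 ^ (q ^ h) * w) ^ (q ^ f)" by simp
          also have "\<dots> = (\<beta> 0 * w + \<beta> 0 ^ (q ^ h) * w) ^ (q ^ f)"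
            by (rule frob_add[symmetric]) (use wF F_mult_right in auto)
          also have "\<dots> = (\<gamma> 0 * w) ^ (q ^ f)" by (simp add: \<gamma>_def distrib_right)
          finally show "(\<beta> 0 * w) ^ (q ^ f) + (\<beta> 0 * w) ^ (q ^ (f + h)) = (\<gamma> 0 * w) ^ (q ^ f)" .
        qed simp
        finally have Tr0: "Tr (\<beta> 0 * w) = (\<Sum>f<h. (\<gamma> 0 * w) ^ (q ^ f))" .
        have "(\<Sum>k\<le>D. \<beta> k * \<omega> j ^ (s + k)) = \<beta> 0 * w + (\<Sum>k<D. \<gamma> (Suc k) * \<omega> j ^ (s + Suc k))"
          unfolding lessThan_Suc_atMost[symmetric] sum.lessThan_Suc_shift
          by (simp add: w_def \<gamma>_def)
        then have "v j = Tr (\<beta> 0 * w + (\<Sum>k<D. \<gamma> (Suc k) * \<omega> j ^ (s + Suc k)))"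
          using j by (simp add: \<beta>(2) encode_def)
        also have "\<dots> = Tr (\<beta> 0 * w) + Tr (\<Sum>k<D. \<gamma> (Suc k) * \<omega> j ^ (s + Suc k))"
          by (rule Tr_add) (use wF \<omega>_power_F[OF j] in \<open>auto intro!: F_sum F_mult_right simp del: add_Suc_right\<close>)
        finally show ?thesis using j Tr0 by (simp add: enc_def w_def)
      qed (simp add: \<beta>(2) encode_def enc_def)
    qed
    ultimately show "v \<in> enc ` C" by blast
  qed
  moreover have "finite C" unfolding C_def using finite_zero_extended[of "Suc D" X] fin by blast
  ultimately have "card A \<le> card C" by (rule surj_card_le[rotated])
  also have "\<dots> = card H * q ^ (m * D)"
    unfolding C_def card_zero_extended[OF fin] prod.lessThan_Suc_shift
    by (simp add: X_def card_F_q power_mult)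
  also have "\<dots> \<le> q ^ h * q ^ (m * D)"
    using card_fixed_le[of h] h_pos by (intro mult_le_mono1) (simp add: H_def)
  finally show ?thesis by (simp add: power_add)
qed

text \<open>\<open>A\<close> has at most \<open>q ^ (h + m * D)\<close> elements and
  \<open>B\<close> at least \<open>q ^ (n - 1 - m * D)\<close>, so there are at least
  \<open>q ^ K\<close> cosets.\<close>

lemma quantum_code_exists:
  assumes K: "K + 2 * m * D + h + 1 = n"
  shows "\<exists>Q. quantum_code q n K (D + 2) Q"
proof -
  obtain g where "bij_betw g {..<q} G"
    using ex_bij_betw_nat_finite[OF finite_G] unfolding card_G atLeast0LessThan by blast
  then have g: "inj_on g {..<q}" "g ` {..<q} = G" by (auto simp: bij_betw_def)
  have "q ^ (K + (h + m * D)) * (q * q ^ (m * D)) = q ^ (K + (h + m * D) + Suc (m * D))"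
    by (simp only: power_add power_Suc)
  also have "K + (h + m * D) + Suc (m * D) = n" using K by simp
  also have "q ^ n \<le> card B * (q * q ^ (m * D))" using card_B_ge by (simp add: mult_ac)
  finally have "q ^ (K + (h + m * D)) \<le> card B" using q_gt_1 by simp
  moreover have "q ^ K * card A \<le> q ^ (K + (h + m * D))"
    unfolding power_add[of q K] using card_A_le by simp
  ultimately have card: "q ^ K * card A \<le> card B" by linarith
  show ?thesis
    by (rule css_code_exists[OF g(1) _ _ _ A_subset_B A_0 A_diff B_diff _ _ card])
      (use B_distance A_projection G_diff in \<open>auto simp: g(2) B_def V_def\<close>)
qed

end

subsection \<open>The parameters\<close>

text \<open>This makes the exponent \<open>K\<close> of the dimension a natural number. In the
  induction the left side grows at most by the factor 9, the right side by
  \<open>q ^ 2\<close>.\<close>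

lemma redundancy_le:
  fixes q h :: nat
  assumes "q \<ge> 3" "h \<ge> 1"
  shows "4 * h * (q - 2) + h + 2 \<le> q ^ (2 * h)"
  using assms(2)
proof (induction h rule: dec_induct)
  case base
  define t where "t = q - 2"
  have t: "q = t + 2" using assms(1) by (simp add: t_def)
  show ?case by (simp add: t power2_eq_square algebra_simps)
next
  case (step h)
  have "q - 2 \<le> h * (q - 2)" using step.hyps by simp
  then have "4 * Suc h * (q - 2) + Suc h + 2 \<le> 9 * (4 * h * (q - 2) + h + 2)"
    by (simp add: algebra_simps)
  also have "\<dots> \<le> q ^ 2 * q ^ (2 * h)"
    using step.IH power_mono[OF assms(1), of 2] by (intro mult_le_mono) simp_all
  also have "\<dots> = q ^ (2 * Suc h)" by (simp flip: power_add)
  finally show ?case .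
qed

theorem theorem4p2:
  fixes q m n c :: nat
  assumes "primepow q" and "q \<ge> 3" and "m \<ge> 2" and "even m"
    and "n = q ^ m - 1"
    and "2 \<le> c" and "c \<le> q"
  shows "\<exists>K Q. int K = int n - 2 * int m * (int c - 2) - int (m div 2) - 1 \<and>
    quantum_code q n K c Q"
proof -
  obtain p l where pl: "prime p" "l > 0" "q = p ^ l"
    using assms(1) by (auto simp: primepow_def)
  define h D where "h = m div 2" and "D = c - 2"
  have h: "m = 2 * h" "h \<ge> 1" using assms(3,4) by (auto simp: h_def)
  have D: "c = D + 2" "D \<le> q - 2" using assms(2,6,7) by (auto simp: D_def)
  have "4 * h * D \<le> 4 * h * (q - 2)" using D(2) by (rule mult_le_mono2)
  then have "4 * h * D + h + 2 \<le> q ^ m"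
    using redundancy_le[OF assms(2) h(2)] unfolding h(1) by linarith
  then have "2 * m * D + h + 1 \<le> n" unfolding assms(5) by (simp add: h(1))
  then obtain K where K: "K + 2 * m * D + h + 1 = n"
    by (metis add.assoc add.commute le_iff_add)
  \<comment> \<open>The field with \<open>p ^ (l * m) = q ^ m\<close> elements, realised inside a
    fixed type.\<close>
  obtain e :: "int poly quotients" where e: "embedded_field_char e p"
    "finite (embedded_field.F e)" "card (embedded_field.F e) = p ^ (l * m)"
    using finite_embedded_field_exists[OF pl(1), of "l * m"] pl(2) assms(3) by auto
  interpret embedded_field_char e p by (rule e)
  interpret finite_field_extension e p l m
    by unfold_locales (use e pl assms(3) in \<open>auto simp: power_mult\<close>)
  have n: "finite_field_extension.n p l m = n"
    by (simp add: n_def q_def assms(5) pl(3))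
  have q: "finite_field_extension.q p l = q"
    by (simp add: q_def pl(3))
  obtain \<omega> where "bij_betw \<omega> {..<n} (F - {0})"
    using ex_bij_betw_nat_finite[of "F - {0}"] finite_F card_nonzero
    by (auto simp: n atLeast0LessThan)
  then interpret bch_css e p l m h D \<omega>
    by unfold_locales (use assms(2,5,7) h D pl(3) in auto)
  have "\<exists>Q. quantum_code q n K c Q"
    using quantum_code_exists[of K] K by (simp add: n q D(1))
  moreover have "int K = int n - 2 * int m * (int c - 2) - int (m div 2) - 1"
    unfolding K[symmetric] by (simp add: D(1) h_def)
  ultimately show ?thesis by blast
qed

end
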